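(* Let $S$ be any analytic quasi-order on $LO\times{}^\omega\omega$ such that ${\preceq_=}\subseteq S\subseteq{\preceq_\ge}$. Then the pair $(S,\cong_=)$ is invariantly universal. In particular $\preceq_=$, $\preceq_\ge$, and every $\preceq_R$ with $R$ a quasi-order on $\omega$ satisfying $R\subseteq{\ge}$, are invariantly universal when paired with $\cong_=$.
   Context: $LO$ is the Polish space of strict linear orders on $\omega$; an element $(L,c)\in LO\times{}^\omega\omega$ is a colored linear order. For a quasi-order $R$ on $\omega$, $(L,c)\preceq_R(L',c')$ iff there is an order embedding $g$ of $L$ into $L'$ with $c(n)\,R\,c'(g(n))$ for all $n$; $\preceq_=$ and $\preceq_\ge$ are the cases where $R$ is equality, resp. $\ge$, on $\omega$. $(L,c)\cong_=(L',c')$ iff there is an order isomorphism $g$ from $L$ onto $L'$ with $c(n)=c'(g(n))$ for all $n$. Borel reducibility: for binary relations $R,R'$ on standard Borel spaces $X,X'$, a Borel $h\colon X\to X'$ with $x\,R\,y \iff h(x)\,R'\,h(y)$ is a Borel reduction, written $R\le_B R'$; $R\sim_B R'$ means $R\le_B R'\le_B R$. For an analytic quasi-order $S$ on a standard Borel space $X$ and an analytic equivalence relation $E\subseteq S\cap S^{-1}$ on $X$, the pair $(S,E)$ is invariantly universal if for every analytic quasi-order $R$ on a standard Borel space there is a Borel $E$-invariant $B\subseteq X$ with $R\sim_B S\restriction B$. *)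

theory Defs
  imports "HOL-Analysis.Analysis"
begin

text \<open>
  A standard Borel space is represented by a \<open>measure\<close> of which only the carrier and the
  sigma-algebra matter. The carrier may be a proper subset of the type, and may be empty.
\<close>

definition standard_borel :: "'a measure \<Rightarrow> bool" where
  "standard_borel X \<longleftrightarrow>
     (\<exists>T. completely_metrizable_space T \<and> second_countable T \<and> topspace T = space X \<and>
          sets X = sigma_sets (space X) {U. openin T U})"

text \<open>
  A subset of a standard Borel space \<open>X\<close> is analytic if it is the projection of a Borel subset
  of the product of \<open>X\<close> with the Baire space.
\<close>

definition analytic_set :: "'a measure \<Rightarrow> 'a set \<Rightarrow> bool" where
  "analytic_set X A \<longleftrightarrow>
     (\<exists>B \<in> sets (X \<Otimes>\<^sub>M (borel :: (nat \<Rightarrow> nat) measure)). A = fst ` B)"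

definition analytic_quasi_order :: "'a measure \<Rightarrow> 'a rel \<Rightarrow> bool" where
  "analytic_quasi_order X R \<longleftrightarrow> preorder_on (space X) R \<and> analytic_set (X \<Otimes>\<^sub>M X) R"

definition analytic_equivalence :: "'a measure \<Rightarrow> 'a rel \<Rightarrow> bool" where
  "analytic_equivalence X E \<longleftrightarrow> equiv (space X) E \<and> analytic_set (X \<Otimes>\<^sub>M X) E"

definition borel_reducible :: "'a measure \<Rightarrow> 'a rel \<Rightarrow> 'b measure \<Rightarrow> 'b rel \<Rightarrow> bool" where
  "borel_reducible X R X' R' \<longleftrightarrow>
     (\<exists>h \<in> X \<rightarrow>\<^sub>M X'. \<forall>x \<in> space X. \<forall>y \<in> space X. (x, y) \<in> R \<longleftrightarrow> (h x, h y) \<in> R')"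

definition borel_bireducible :: "'a measure \<Rightarrow> 'a rel \<Rightarrow> 'b measure \<Rightarrow> 'b rel \<Rightarrow> bool" where
  "borel_bireducible X R X' R' \<longleftrightarrow> borel_reducible X R X' R' \<and> borel_reducible X' R' X R"

text \<open>
  The quantifier over all standard Borel spaces is split in two: it ranges over the spaces
  \<open>Y\<close> whose points have type \<open>'b\<close>, and the type \<open>'b\<close> is a parameter to be left
  arbitrary in theorems. The first line consists of the standing assumptions under which
  invariant universality of a pair is defined.
\<close>

definition invariantly_universal ::
    "'b itself \<Rightarrow> 'a measure \<Rightarrow> 'a rel \<Rightarrow> 'a rel \<Rightarrow> bool" where
  "invariantly_universal (_ :: 'b itself) X S E \<longleftrightarrow>
     standard_borel X \<and> analytic_quasi_order X S \<and> analytic_equivalence X E \<and> E \<subseteq> S \<inter> S\<inverse> \<and>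
     (\<forall>(Y :: 'b measure) R. standard_borel Y \<and> analytic_quasi_order Y R \<longrightarrow>
        (\<exists>B \<in> sets X. E `` B \<subseteq> B \<and> borel_bireducible Y R (restrict_space X B) (Restr S B)))"

text \<open>
  Binary relations on \<open>\<omega>\<close> are identified with their characteristic functions, whose type
  carries the product topology with \<open>bool\<close> discrete, i.e. that of the Cantor space.
\<close>

definition LO :: "(nat \<times> nat \<Rightarrow> bool) set" where
  "LO = {L. strict_linear_order_on UNIV (Collect L)}"

type_synonym colored_order = "(nat \<times> nat \<Rightarrow> bool) \<times> (nat \<Rightarrow> nat)"

definition colored_LO :: "colored_order measure" where
  "colored_LO = restrict_space borel (LO \<times> UNIV)"

definition order_embedding ::
    "(nat \<times> nat \<Rightarrow> bool) \<Rightarrow> (nat \<times> nat \<Rightarrow> bool) \<Rightarrow> (nat \<Rightarrow> nat) \<Rightarrow> bool" where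
  "order_embedding L L' g \<longleftrightarrow> inj g \<and> (\<forall>m n. L (m, n) \<longleftrightarrow> L' (g m, g n))"

definition colored_emb :: "nat rel \<Rightarrow> colored_order rel" where
  "colored_emb R =
     {((L, c), (L', c')). L \<in> LO \<and> L' \<in> LO \<and>
        (\<exists>g. order_embedding L L' g \<and> (\<forall>n. (c n, c' (g n)) \<in> R))}"

definition colored_iso :: "colored_order rel" where
  "colored_iso =
     {((L, c), (L', c')). L \<in> LO \<and> L' \<in> LO \<and>
        (\<exists>g. order_embedding L L' g \<and> surj g \<and> (\<forall>n. c n = c' (g n)))}"

abbreviation geq_rel :: "nat rel" where
  "geq_rel \<equiv> {(m, n). m \<ge> n}"

end

theory Submission
  imports Defs "HOL-Library.List_Lexorder"
begin

text \<open>
  Code the points of a standard Borel space by pairwise incomparable 0-1 sequences; an analytic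
  quasi-order \<open>R\<close> becomes the projection of a closed set \<open>F\<close>. Following Louveau and Rosendal, finite
  approximations to \<open>R\<close> are made additive: \<open>link\<close> bounds both the length of a chain of \<open>F\<close>-steps and
  the sum of their certificates, and by compactness a pair linked at every finite level is in \<open>R\<close>.
  A sequence \<open>a\<close> is turned into the tree of all finite sequences \<open>p\<close> whose parities are linked to
  \<open>a\<close> with bound \<open>p div 2\<close>; its nodes and their one-point extensions are ordered lexicographically
  and coloured by their level and last parity. If \<open>a R b\<close> with certificate \<open>w\<close>, adding twice
  \<open>w + 1\<close> coordinatewise embeds the order of \<open>a\<close> into that of \<open>b\<close> and preserves colours.
  Conversely, below a node the points of the next level form a sequence of type \<open>\<omega>\<close>, and an embedding
  that does not raise colours must send a tail of it below one node of the same level. Following a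
  branch with parities \<open>a\<close> yields \<open>v\<close>, pointwise below \<open>a\<close>, with \<open>v R b\<close>, and \<open>v = a\<close> by incomparability.
  These orders are rigid: each point is determined by counting points below it. Hence the
  isomorphism closure of the image is Borel and the code of \<open>a\<close> can be read off in a Borel way.
\<close>

section \<open>Additive approximations of an analytic quasi-order\<close>

text \<open>Koenig's lemma by repeated pigeonhole: nested infinite index sets, each fixing one more
  coordinate of the witnesses, yield the limit \<open>f\<close>. A witness with index in
  \<open>I n\<close> and at least \<open>n\<close> agrees with \<open>f\<close> below
  \<open>n\<close>, which is all that \<open>Q n\<close> sees.\<close>

lemma konig_sequences:
  fixes Q :: "nat \<Rightarrow> (nat \<Rightarrow> 'a) \<Rightarrow> bool"
  assumes fin: "\<And>k. finite (A k)"
    and ex: "\<And>n. \<exists>d. (\<forall>k. d k \<in> A k) \<and> Q n d"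
    and cong: "\<And>n d d'. Q n d \<Longrightarrow> \<forall>k<n. d k = d' k \<Longrightarrow> Q n d'"
    and mono: "\<And>m n d. Q n d \<Longrightarrow> m \<le> n \<Longrightarrow> Q m d"
  obtains f where "\<And>n. Q n f"
proof -
  have "\<exists>d. \<forall>n. (\<forall>k. d n k \<in> A k) \<and> Q n (d n)"
    by (intro choice allI ex)
  then obtain d where dA: "\<And>n k. d n k \<in> A k" and dQ: "\<And>n. Q n (d n)"
    by blast
  have "\<exists>J. infinite J \<and> (J \<subseteq> I \<and> (\<exists>a. \<forall>n\<in>J. d n k = a))" if inf: "infinite I" for I and k
  proof -
    have "finite ((\<lambda>n. d n k) ` I)"
      by (rule finite_subset[OF _ fin[of k]]) (auto simp: dA)
    then obtain a where "infinite {n \<in> I. d n k = d a k}"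
      using pigeonhole_infinite[OF inf, of "\<lambda>n. d n k"] by blast
    then show ?thesis
      by (intro exI[of _ "{n \<in> I. d n k = d a k}"]) auto
  qed
  then have "\<exists>I. \<forall>k. infinite (I k) \<and> (I (Suc k) \<subseteq> I k \<and> (\<exists>a. \<forall>n\<in>I (Suc k). d n k = a))"
    using infinite_UNIV_nat by (intro dependent_nat_choice) auto
  then obtain I where step: "\<forall>k. infinite (I k) \<and>
      (I (Suc k) \<subseteq> I k \<and> (\<exists>a. \<forall>n\<in>I (Suc k). d n k = a))" ..
  then have I: "infinite (I k)" "I (Suc k) \<subseteq> I k" and const: "\<exists>a. \<forall>n\<in>I (Suc k). d n k = a" for k
    by auto
  define f where "f k = (SOME a. \<forall>n\<in>I (Suc k). d n k = a)" for k
  have f: "d n k = f k" if "n \<in> I (Suc k)" for n k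
    using someI_ex[OF const[of k]] that unfolding f_def by blast
  show thesis
  proof
    fix n
    obtain m where m: "m \<in> I n" "n \<le> m"
      using I(1)[of n] unfolding infinite_nat_iff_unbounded_le by blast
    have "I n \<subseteq> I k" if "k \<le> n" for k
      by (rule lift_Suc_antimono_le[of I, OF I(2) that])
    then have "\<forall>k<n. d m k = f k"
      using m(1) f by (simp add: Suc_leI subset_iff)
    moreover have "Q n (d m)"
      using dQ m(2) by (rule mono)
    ultimately show "Q n f"
      using cong by blast
  qed
qed

section \<open>Finite approximations and chains of approximate steps\<close>

type_synonym baire = "nat \<Rightarrow> nat"

text \<open>The restrictions to length \<open>n\<close> lie in the tree of \<open>F\<close>; for
  closed \<open>F\<close> this tree determines membership (\<open>closed_approx\<close>).\<close>

definition approx :: "(baire \<times> baire \<times> baire) set \<Rightarrow> nat \<Rightarrow> baire \<Rightarrow> baire \<Rightarrow> baire \<Rightarrow> bool" where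
  "approx F n a b w \<longleftrightarrow>
     (\<exists>a' b' w'. (a', b', w') \<in> F \<and> (\<forall>k<n. a' k = a k \<and> b' k = b k \<and> w' k = w k))"

lemma approx_mono: "approx F n a b w \<Longrightarrow> m \<le> n \<Longrightarrow> approx F m a b w"
  unfolding approx_def by (meson less_le_trans)

lemma approx_cong:
  assumes "\<And>k. k < n \<Longrightarrow> a k = a' k \<and> b k = b' k \<and> w k = w' k"
  shows "approx F n a b w \<longleftrightarrow> approx F n a' b' w'"
  using assms unfolding approx_def by (metis (lifting))

lemma cylinder_LIMSEQ:
  fixes X :: "nat \<Rightarrow> baire"
  assumes "\<And>n k. k < n \<Longrightarrow> X n k = a k"
  shows "X \<longlonglongrightarrow> a"
proof -
  have "((\<lambda>n. X n k) \<longlongrightarrow> a k) sequentially" for k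
    by (rule tendsto_eventually) (use assms in \<open>auto intro!: eventually_sequentiallyI[of "Suc k"]\<close>)
  then have "limitin (product_topology (\<lambda>_. euclidean) UNIV) X a sequentially"
    by (simp add: limitin_componentwise)
  then show ?thesis
    by (simp add: euclidean_product_topology)
qed

lemma closed_approx:
  assumes "closed F" and "\<And>n. approx F n a b w"
  shows "(a, b, w) \<in> F"
proof -
  obtain A B W where F: "\<And>n. (A n, B n, W n) \<in> F"
    and eq: "\<And>n k. k < n \<Longrightarrow> A n k = a k \<and> B n k = b k \<and> W n k = w k"
    using assms(2) unfolding approx_def by metis
  have "(\<lambda>n. (A n, B n, W n)) \<longlonglongrightarrow> (a, b, w)"
    by (intro tendsto_Pair cylinder_LIMSEQ) (use eq in auto)
  then show ?thesis
    by (rule closed_sequentially[OF assms(1), rotated]) (rule F)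
qed

text \<open>
  Finite approximations to \<open>a R b\<close>, where the reflexive closure \<open>R\<close> of the projection of \<open>F\<close> is
  transitive: a chain from \<open>a\<close> to \<open>b\<close> whose length is the first entry of the bound \<open>s\<close>, so that
  both chain lengths and certificates add up when two chains are composed.
\<close>
definition link :: "(baire \<times> baire \<times> baire) set \<Rightarrow> nat \<Rightarrow> baire \<Rightarrow> baire \<Rightarrow> baire \<Rightarrow> bool" where
  "link F n s a b \<longleftrightarrow>
     (\<exists>(z :: nat \<Rightarrow> baire) (w :: nat \<Rightarrow> baire).
        (\<forall>i k. z i k \<le> 1) \<and> (\<forall>k<n. z 0 k = a k) \<and> (\<forall>k<n. z (s 0) k = b k) \<and>
        (\<forall>i<s 0. (\<forall>k<n. z i k = z (Suc i) k) \<or> approx F n (z i) (z (Suc i)) (w i)) \<and>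
        (\<forall>k<n. (\<Sum>i<s 0. w i k) \<le> s k))"

text \<open>Idle steps are allowed in a chain, so a constant chain with zero certificates has any
  length \<open>s 0\<close> and respects any bound.\<close>

lemma link_refl: "(\<And>k. a k \<le> 1) \<Longrightarrow> link F n s a a"
  unfolding link_def by (rule exI[of _ "\<lambda>_. a"], rule exI[of _ "\<lambda>_ _. 0"]) auto

lemma link_mono:
  assumes "link F n s a b" "m \<le> n"
  shows "link F m s a b"
proof -
  obtain z w where zw: "\<forall>i k. z i k \<le> (1::nat)" "\<forall>k<n. z 0 k = a k" "\<forall>k<n. z (s 0) k = b k"
    "\<forall>i<s 0. (\<forall>k<n. z i k = z (Suc i) k) \<or> approx F n (z i) (z (Suc i)) (w i)"
    "\<forall>k<n. (\<Sum>i<s 0. w i k) \<le> s k"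
    using assms(1) unfolding link_def by blast
  have "\<forall>i<s 0. (\<forall>k<m. z i k = z (Suc i) k) \<or> approx F m (z i) (z (Suc i)) (w i)"
    using zw(4) approx_mono[OF _ assms(2)] assms(2) by (meson less_le_trans)
  then show ?thesis
    unfolding link_def using zw assms(2)
    by (intro exI[of _ z] exI[of _ w]) (auto)
qed

lemma link_cong:
  assumes "link F n s a b" and "\<And>k. k < n \<Longrightarrow> s k = s' k \<and> a k = a' k \<and> b k = b' k"
  shows "link F n s' a' b'"
proof (cases "n = 0")
  \<comment> \<open>At level \<open>0\<close> the hypotheses say nothing about the chain length
    \<open>s 0\<close>, but every condition is vacuous there.\<close>
  case True
  then show ?thesis
    unfolding link_def by (intro exI[of _ "\<lambda>_ _. 0"]) auto
next
  case False
  then have "s 0 = s' 0"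
    using assms by simp
  then show ?thesis
    using assms unfolding link_def by (simp cong: conj_cong)
qed

lemma sum_concat:
  fixes f g :: "nat \<Rightarrow> nat"
  shows "(\<Sum>i<p + q. if i < p then f i else g (i - p)) = (\<Sum>i<p. f i) + (\<Sum>i<q. g i)"
  by (induction q) auto

text \<open>Concatenation of chains. Entry \<open>0\<close> of a bound is the length, so lengths and
  certificates are added by the same pointwise sum.\<close>

lemma link_trans:
  assumes "link F n s a b" "link F n t b c"
  shows "link F n (\<lambda>k. s k + t k) a c"
proof -
  obtain z w where zw: "\<forall>i k. z i k \<le> (1::nat)" "\<forall>k<n. z 0 k = a k" "\<forall>k<n. z (s 0) k = b k"
    "\<forall>i<s 0. (\<forall>k<n. z i k = z (Suc i) k) \<or> approx F n (z i) (z (Suc i)) (w i)"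
    "\<forall>k<n. (\<Sum>i<s 0. w i k) \<le> s k"
    using assms(1) unfolding link_def by blast
  obtain z' w' where zw': "\<forall>i k. z' i k \<le> (1::nat)" "\<forall>k<n. z' 0 k = b k" "\<forall>k<n. z' (t 0) k = c k"
    "\<forall>i<t 0. (\<forall>k<n. z' i k = z' (Suc i) k) \<or> approx F n (z' i) (z' (Suc i)) (w' i)"
    "\<forall>k<n. (\<Sum>i<t 0. w' i k) \<le> t k"
    using assms(2) unfolding link_def by blast
  define Z where "Z = (\<lambda>i. if i < s 0 then z i else z' (i - s 0))"
  define W where "W = (\<lambda>i. if i < s 0 then w i else w' (i - s 0))"
  \<comment> \<open>At the junction \<open>s 0\<close> the two chains agree only below
    \<open>n\<close>; \<open>Z\<close> follows \<open>z'\<close> from there on, and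
    \<open>approx_cong\<close> absorbs the difference.\<close>
  have Zl: "\<forall>k<n. Z i k = z i k" if "i \<le> s 0" for i
    using that zw(3) zw'(2) by (cases "i = s 0") (auto simp: Z_def)
  have Zr: "Z (s 0 + i) = z' i" for i
    by (simp add: Z_def)
  have step: "(\<forall>k<n. Z i k = Z (Suc i) k) \<or> approx F n (Z i) (Z (Suc i)) (W i)" if i: "i < s 0 + t 0" for i
  proof (cases "i < s 0")
    case True
    then have "\<forall>k<n. Z i k = z i k" "\<forall>k<n. Z (Suc i) k = z (Suc i) k" "W i = w i"
      using Zl[of i] Zl[of "Suc i"] by (auto simp: W_def)
    moreover from this have "approx F n (Z i) (Z (Suc i)) (W i) \<longleftrightarrow> approx F n (z i) (z (Suc i)) (w i)"
      by (intro approx_cong) auto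
    ultimately show ?thesis
      using zw(4) True by simp
  next
    case False
    then obtain j where j: "i = s 0 + j"
      by (metis add_diff_inverse_nat)
    then have "Z i = z' j" "Z (Suc i) = z' (Suc j)" "W i = w' j" "j < t 0"
      using Zr[of j] Zr[of "Suc j"] i by (auto simp: W_def)
    then show ?thesis
      using zw'(4) by simp
  qed
  have "(\<Sum>i<s 0 + t 0. W i k) = (\<Sum>i<s 0. w i k) + (\<Sum>i<t 0. w' i k)" for k
    by (subst sum_concat[symmetric]) (auto simp: W_def intro!: sum.cong)
  then have "\<forall>k<n. (\<Sum>i<s 0 + t 0. W i k) \<le> s k + t k"
    using zw(5) zw'(5) by (simp add: add_mono)
  moreover have "\<forall>i k. Z i k \<le> 1"
    using zw(1) zw'(1) by (simp add: Z_def)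
  ultimately show ?thesis
    unfolding link_def using step Zl[of 0] zw(2) zw'(3) Zr
    by (intro exI[of _ Z] exI[of _ W]) auto
qed

text \<open>One genuine step followed by \<open>w 0\<close> idle ones: \<open>Suc\<close> makes the
  length positive, and the certificate \<open>w\<close> is spent on step \<open>0\<close>
  alone.\<close>

lemma link_step:
  assumes "(a, b, w) \<in> F" "\<And>k. a k \<le> 1" "\<And>k. b k \<le> 1"
  shows "link F n (\<lambda>k. Suc (w k)) a b"
proof -
  let ?z = "\<lambda>i. if i = (0::nat) then a else b"
  let ?w = "\<lambda>i k. if i = (0::nat) then w k else 0"
  have "approx F n a b w"
    using assms(1) unfolding approx_def by blast
  moreover have "(\<Sum>i<Suc m. ?w i k) = w k" for m k
    by (subst lessThan_Suc_eq_insert_0) (simp add: sum.insert_if)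
  ultimately show ?thesis
    unfolding link_def using assms(2,3)
    by (intro exI[of _ ?z] exI[of _ ?w]) (auto simp: le_SucI)
qed

lemma link_0_eq: "link F n s a b \<Longrightarrow> s 0 = 0 \<Longrightarrow> k < n \<Longrightarrow> a k = b k"
  unfolding link_def by auto

text \<open>Compactness: the length \<open>s 0\<close> is fixed, and at coordinate \<open>k\<close>
  the chain has bits and certificates of size at most \<open>s k\<close>, so finitely many columns
  are possible and one chain works at every level. Closedness makes each of its steps an equality or
  a member of \<open>F\<close>, and transitivity contracts it.\<close>

lemma link_limit:
  assumes F: "closed F" and s: "\<And>n. link F n s a b"
    and trans: "\<And>a b c w w'. (a, b, w) \<in> F \<Longrightarrow> (b, c, w') \<in> F \<Longrightarrow> \<exists>w. (a, c, w) \<in> F"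
  shows "a = b \<or> (\<exists>w. (a, b, w) \<in> F)"
proof -
  \<comment> \<open>\<open>d k\<close> is the column at coordinate \<open>k\<close>: the values
    there of all chain points and of all certificates.\<close>
  define Q :: "nat \<Rightarrow> (nat \<Rightarrow> baire \<times> baire) \<Rightarrow> bool" where
    "Q n d \<longleftrightarrow> (\<forall>k<n. fst (d k) 0 = a k) \<and> (\<forall>k<n. fst (d k) (s 0) = b k) \<and>
        (\<forall>i<s 0. (\<forall>k<n. fst (d k) i = fst (d k) (Suc i)) \<or>
           approx F n (\<lambda>k. fst (d k) i) (\<lambda>k. fst (d k) (Suc i)) (\<lambda>k. snd (d k) i))" for n d
  \<comment> \<open>Entries outside the chain are set to \<open>0\<close> to keep the columns finite
    in number.\<close>
  define A :: "nat \<Rightarrow> (baire \<times> baire) set" where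
    "A k = {f. \<forall>i. (i \<in> {..s 0} \<longrightarrow> f i \<in> {..1}) \<and> (i \<notin> {..s 0} \<longrightarrow> f i = 0)} \<times>
           {f. \<forall>i. (i \<in> {..<s 0} \<longrightarrow> f i \<in> {..s k}) \<and> (i \<notin> {..<s 0} \<longrightarrow> f i = 0)}" for k
  have "\<exists>d. \<forall>n. Q n d"
  proof (rule konig_sequences[of A Q])
    show "finite (A k)" for k
      unfolding A_def by (intro finite_cartesian_product finite_set_of_finite_funs) auto
    show "\<exists>d. (\<forall>k. d k \<in> A k) \<and> Q n d" for n
    proof -
      obtain z w where zw: "\<forall>i k. z i k \<le> (1::nat)" "\<forall>k<n. z 0 k = a k" "\<forall>k<n. z (s 0) k = b k"
        "\<forall>i<s 0. (\<forall>k<n. z i k = z (Suc i) k) \<or> approx F n (z i) (z (Suc i)) (w i)"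
        "\<forall>k<n. (\<Sum>i<s 0. w i k) \<le> s k"
        using s[of n] unfolding link_def by blast
      define d :: "nat \<Rightarrow> baire \<times> baire" where
        "d k = (\<lambda>i. if i \<le> s 0 then z i k else 0, \<lambda>i. if i < s 0 \<and> k < n then w i k else 0)" for k
      have "w i k \<le> s k" if "i < s 0" "k < n" for i k
      proof -
        have "w i k \<le> (\<Sum>i<s 0. w i k)"
          using that by (intro member_le_sum) auto
        then show ?thesis
          using zw(5) that by (meson order_trans)
      qed
      then have "\<forall>k. d k \<in> A k"
        using zw(1) by (auto simp: d_def A_def)
      moreover have "approx F n (\<lambda>k. fst (d k) i) (\<lambda>k. fst (d k) (Suc i)) (\<lambda>k. snd (d k) i)
          \<longleftrightarrow> approx F n (z i) (z (Suc i)) (w i)" if "i < s 0" for i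
        using that by (intro approx_cong) (auto simp: d_def)
      then have "Q n d"
        using zw(2-4) unfolding Q_def by (auto simp: d_def)
      ultimately show ?thesis
        by blast
    qed
    show "Q n d'" if Q: "Q n d" and eq: "\<forall>k<n. d k = d' k" for n d d'
    proof -
      have "approx F n (\<lambda>k. fst (d k) i) (\<lambda>k. fst (d k) (Suc i)) (\<lambda>k. snd (d k) i)
          \<longleftrightarrow> approx F n (\<lambda>k. fst (d' k) i) (\<lambda>k. fst (d' k) (Suc i)) (\<lambda>k. snd (d' k) i)" for i
        using eq by (intro approx_cong) auto
      then show ?thesis
        using Q eq unfolding Q_def by auto
    qed
    show "Q m d" if "Q n d" "m \<le> n" for m n d
      using that approx_mono[OF _ \<open>m \<le> n\<close>] unfolding Q_def by (meson less_le_trans)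
  qed blast
  then obtain d where d: "\<And>n. Q n d"
    by blast
  define z where "z i k = fst (d k) i" for i k
  have z: "z 0 = a" "z (s 0) = b"
    using d unfolding Q_def z_def by blast+
  have step: "z i = z (Suc i) \<or> (z i, z (Suc i), \<lambda>k. snd (d k) i) \<in> F" if "i < s 0" for i
  proof (rule disjCI)
    assume "(z i, z (Suc i), \<lambda>k. snd (d k) i) \<notin> F"
    then obtain m where m: "\<not> approx F m (z i) (z (Suc i)) (\<lambda>k. snd (d k) i)"
      using closed_approx[OF F] by blast
    \<comment> \<open>Failure of \<open>approx\<close> at level \<open>m\<close> persists at higher
      levels, which leaves only the alternative of equality.\<close>
    have "z i k = z (Suc i) k" for k
    proof -
      have "\<not> approx F (max m (Suc k)) (z i) (z (Suc i)) (\<lambda>k. snd (d k) i)"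
        using m approx_mono by (meson max.cobounded1)
      then show ?thesis
        using d[of "max m (Suc k)"] that unfolding Q_def z_def by auto
    qed
    then show "z i = z (Suc i)" ..
  qed
  have "i \<le> s 0 \<Longrightarrow> a = z i \<or> (\<exists>w. (a, z i, w) \<in> F)" for i
  proof (induction i)
    case (Suc i)
    then show ?case
      using step[of i] trans by (metis Suc_leD Suc_le_eq)
  qed (simp add: z)
  then show ?thesis
    using z(2) by blast
qed

section \<open>Coding standard Borel spaces\<close>

definition souslin :: "'a::topological_space set \<Rightarrow> bool" where
  "souslin A \<longleftrightarrow> (\<exists>F :: ('a \<times> baire) set. closed F \<and> A = fst ` F)"

text \<open>Entry \<open>0\<close> of the witness selects the index, and the rest is a witness for
  the selected set.\<close>

lemma souslin_UN:
  assumes "\<And>i::nat. souslin (A i)"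
  shows "souslin (\<Union>i. A i)"
proof -
  obtain F :: "nat \<Rightarrow> ('a \<times> baire) set"
    where F: "\<And>i. closed (F i)" and A: "\<And>i. A i = fst ` F i"
    using assms unfolding souslin_def by metis
  define G where "G = {(x, \<xi> :: baire). (x, \<lambda>k. \<xi> (Suc k)) \<in> F (\<xi> 0)}"
  have "closed {p :: 'a \<times> baire. snd p 0 \<noteq> i \<or> (fst p, \<lambda>k. snd p (Suc k)) \<in> F i}" for i
  proof -
    have "closed ((\<lambda>p :: 'a \<times> baire. snd p 0) -` (- {i}))"
      by (intro closed_vimage closed_Compl open_discrete continuous_intros
          continuous_on_product_then_coordinatewise)
    moreover have "closed ((\<lambda>p :: 'a \<times> baire. (fst p, \<lambda>k. snd p (Suc k))) -` F i)"
      by (intro closed_vimage F continuous_intros continuous_on_product_then_coordinatewise)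
    ultimately have "closed ((\<lambda>p :: 'a \<times> baire. snd p 0) -` (- {i}) \<union>
        (\<lambda>p :: 'a \<times> baire. (fst p, \<lambda>k. snd p (Suc k))) -` F i)"
      by (rule closed_Un)
    then show ?thesis
      by (rule back_subst[of closed]) auto
  qed
  then have "closed (\<Inter>i. {p :: 'a \<times> baire. snd p 0 \<noteq> i \<or> (fst p, \<lambda>k. snd p (Suc k)) \<in> F i})"
    by blast
  then have "closed G"
    by (rule back_subst[of closed]) (auto simp: G_def)
  moreover have "(\<Union>i. A i) = fst ` G"
  proof (intro equalityI subsetI)
    fix x assume "x \<in> (\<Union>i. A i)"
    then obtain i \<xi> where "(x, \<xi>) \<in> F i"
      using A by force
    then have "(x, \<lambda>k. case k of 0 \<Rightarrow> i | Suc k \<Rightarrow> \<xi> k) \<in> G"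
      by (simp add: G_def)
    then show "x \<in> fst ` G"
      by force
  next
    fix x assume "x \<in> fst ` G"
    then obtain \<xi> where "(x, \<lambda>k. \<xi> (Suc k)) \<in> F (\<xi> 0)"
      by (auto simp: G_def)
    then have "x \<in> A (\<xi> 0)"
      using A by force
    then show "x \<in> (\<Union>i. A i)"
      by blast
  qed
  ultimately show ?thesis
    unfolding souslin_def by blast
qed

text \<open>One sequence holds witnesses for all indices: row \<open>i\<close> under the pairing
  \<open>prod_encode\<close> serves \<open>A i\<close>.\<close>

lemma souslin_INT:
  assumes "\<And>i::nat. souslin (A i)"
  shows "souslin (\<Inter>i. A i)"
proof -
  obtain F :: "nat \<Rightarrow> ('a \<times> baire) set"
    where F: "\<And>i. closed (F i)" and A: "\<And>i. A i = fst ` F i"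
    using assms unfolding souslin_def by metis
  define G where "G = (\<Inter>i. (\<lambda>p :: 'a \<times> baire. (fst p, \<lambda>k. snd p (prod_encode (i, k)))) -` F i)"
  have "closed G"
    unfolding G_def
    by (intro closed_INT ballI closed_vimage F continuous_intros continuous_on_product_then_coordinatewise)
  moreover have "(\<Inter>i. A i) = fst ` G"
  proof (intro equalityI subsetI)
    fix x assume "x \<in> (\<Inter>i. A i)"
    then have "\<forall>i. \<exists>\<xi>. (x, \<xi>) \<in> F i"
      using A by force
    then obtain \<xi> where "\<And>i. (x, \<xi> i) \<in> F i"
      by metis
    then have "(x, \<lambda>n. \<xi> (fst (prod_decode n)) (snd (prod_decode n))) \<in> G"
      by (simp add: G_def)
    then show "x \<in> fst ` G"
      by force
  next
    fix x assume "x \<in> fst ` G"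
    then obtain \<xi> where "\<And>i. (x, \<lambda>k. \<xi> (prod_encode (i, k))) \<in> F i"
      by (auto simp: G_def)
    then have "x \<in> A i" for i
      using A by force
    then show "x \<in> (\<Inter>i. A i)"
      by blast
  qed
  ultimately show ?thesis
    unfolding souslin_def by blast
qed

lemma closed_imp_souslin: "closed A \<Longrightarrow> souslin A"
  unfolding souslin_def by (intro exI[of _ "A \<times> UNIV"]) (auto simp: closed_Times)

lemma completely_metrizable_space_discrete:
  "completely_metrizable_space (euclidean :: 'a::discrete_topology topology)"
proof -
  have "(euclidean :: 'a topology) = discrete_topology UNIV"
    by (simp add: topology_eq open_discrete)
  then show ?thesis
    by (simp add: completely_metrizable_space_discrete_topology)
qed

lemma completely_metrizable_space_fun:
  assumes "completely_metrizable_space (euclidean :: 'b topology)"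
  shows "completely_metrizable_space (euclidean :: ('a::countable \<Rightarrow> 'b::topological_space) topology)"
  unfolding euclidean_product_topology[symmetric]
  using assms by (simp add: completely_metrizable_space_product_topology countable_subset)

lemma completely_metrizable_space_prod:
  assumes "completely_metrizable_space (euclidean :: 'a::topological_space topology)"
    and "completely_metrizable_space (euclidean :: 'b::topological_space topology)"
  shows "completely_metrizable_space (euclidean :: ('a \<times> 'b) topology)"
  unfolding prod_topology_euclidean[symmetric] completely_metrizable_space_prod_topology
  using assms by simp

text \<open>Complements are carried through the induction over the sigma-algebra generated by the
  closed sets. Metrizability enters at the generators, as it makes open sets countable unions of
  closed ones.\<close>

lemma borel_imp_souslin:
  assumes metrizable: "metrizable_space (euclidean :: 'a::topological_space topology)"
    and "A \<in> sets (borel :: 'a measure)"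
  shows "souslin A"
proof -
  have "A \<in> sigma_sets UNIV (Collect closed)"
    using assms(2) by (simp add: borel_eq_closed)
  then have "souslin A \<and> souslin (- A)"
  proof (induction rule: sigma_sets.induct)
    case (Basic a)
    then have "open (- a)"
      by (simp add: open_Compl)
    then have "fsigma_in euclidean (- a)"
      by (intro open_imp_fsigma_in metrizable) simp
    then obtain C :: "nat \<Rightarrow> 'a set" where "\<And>n. closed (C n)" "\<Union> (range C) = - a"
      by (auto simp: fsigma_in_ascending)
    then show ?case
      using Basic souslin_UN[of C] by (auto simp: closed_imp_souslin)
  next
    case (Union a)
    then show ?case
      using souslin_UN[of a] souslin_INT[of "\<lambda>i. - a i"] by (auto simp: Compl_UN)
  qed (auto simp: closed_imp_souslin Compl_eq_Diff_UNIV[symmetric])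
  then show ?thesis ..
qed

section \<open>Coding points of a separable complete metric space by rational balls\<close>

definition ball_bit :: "baire \<Rightarrow> nat \<Rightarrow> rat \<Rightarrow> bool" where
  "ball_bit a k r \<longleftrightarrow> a (to_nat (k, r, True)) = 1"

lemma measurable_entry [measurable]: "(\<lambda>a :: baire. a n) \<in> borel \<rightarrow>\<^sub>M count_space UNIV"
proof -
  have "(\<lambda>a :: baire. a n) \<in> borel \<rightarrow>\<^sub>M borel"
    by (rule measurable_product_coordinates)
  then show ?thesis
    by (simp add: measurable_cong_sets[OF refl sets_borel_eq_count_space])
qed

lemma measurable_ball_bit [measurable]: "Measurable.pred borel (\<lambda>a. ball_bit a k r)"
  unfolding ball_bit_def by measurable

context Metric_space
begin

text \<open>
  Half of the coordinates record membership in the balls around the points \<open>q k\<close> and the other half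
  membership in their complements; this makes distinct codes pointwise incomparable.
\<close>
definition ball_code :: "(nat \<Rightarrow> 'a) \<Rightarrow> 'a \<Rightarrow> baire" where
  "ball_code q y n =
     (case from_nat n of (k :: nat, r :: rat, s) \<Rightarrow> of_bool ((d y (q k) < of_rat r) = s))"

text \<open>These are countably many conditions on coordinates, so they define a Borel set; for
  \<open>q\<close> dense in a complete space it is exactly the image of \<open>ball_code q\<close>.
  The last clause expresses that balls are open.\<close>

definition code_cond :: "(nat \<Rightarrow> 'a) \<Rightarrow> baire \<Rightarrow> bool" where
  "code_cond q a \<longleftrightarrow>
     (\<forall>n. case from_nat n of (k, r, s) \<Rightarrow> a n = of_bool (ball_bit a k r = s)) \<and>
     (\<forall>m. \<exists>k. ball_bit a k (1 / of_nat (Suc m))) \<and>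
     (\<forall>j k s t. ball_bit a j s \<and> ball_bit a k t \<longrightarrow> d (q j) (q k) < of_rat s + of_rat t) \<and>
     (\<forall>j r. ball_bit a j r \<longleftrightarrow> (\<exists>k t. ball_bit a k t \<and> d (q k) (q j) + of_rat t < of_rat r))"

lemma ball_bit_code [simp]: "ball_bit (ball_code q y) k r \<longleftrightarrow> d y (q k) < of_rat r"
  by (simp add: ball_bit_def ball_code_def)

lemma code_cond_code:
  assumes q: "range q \<subseteq> M" and dense: "\<forall>x\<in>M. \<forall>\<epsilon>>0. \<exists>k. d x (q k) < \<epsilon>" and y: "y \<in> M"
  shows "code_cond q (ball_code q y)"
proof -
  have qM: "q k \<in> M" for k
    using q by auto
  have "\<exists>k. d y (q k) < of_rat (1 / of_nat (Suc m))" for m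
    by (rule dense[rule_format, OF y]) (simp add: of_rat_divide of_rat_add)
  moreover have "d (q j) (q k) < s + t" if "d y (q j) < s" "d y (q k) < t" for j k s t
    using that triangle[of "q j" y "q k"] qM y by (simp add: commute)
  moreover have "(\<exists>k t. d y (q k) < of_rat t \<and> d (q k) (q j) + of_rat t < of_rat r) \<longleftrightarrow> d y (q j) < of_rat r"
    for j r
  proof
    assume "\<exists>k t. d y (q k) < of_rat t \<and> d (q k) (q j) + of_rat t < of_rat r"
    then show "d y (q j) < of_rat r"
      using triangle[OF y qM qM] commute by (smt (verit))
  next
    assume "d y (q j) < of_rat r"
    \<comment> \<open>\<open>t\<close> is below half of the slack, so a centre within
      \<open>t\<close> of \<open>y\<close> leaves room for another \<open>t\<close>.\<close>
    then obtain t where t: "0 < t" "t < (of_rat r - d y (q j)) / 2" "t \<in> \<rat>"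
      using Rats_dense_in_real[of 0 "(of_rat r - d y (q j)) / 2"] by auto
    obtain k where k: "d y (q k) < t"
      using dense[rule_format, OF y t(1)] by blast
    have "d (q k) (q j) \<le> d y (q k) + d y (q j)"
      using triangle[OF qM y qM, of k j] by (simp add: commute)
    then have "d (q k) (q j) + t < of_rat r"
      using k t(2) by (simp add: field_simps)
    then show "\<exists>k t. d y (q k) < of_rat t \<and> d (q k) (q j) + of_rat t < of_rat r"
      using k t(3) by (metis Rats_cases)
  qed
  ultimately show ?thesis
    unfolding code_cond_def by (auto simp: ball_code_def split: prod.splits)
qed

text \<open>The centres of the balls of radius \<open>1 / (m + 1)\<close> selected by the code form
  a Cauchy sequence, whose limit is the coded point.\<close>

lemma code_cond_imp_code:
  assumes q: "range q \<subseteq> M" and complete: mcomplete and a: "code_cond q a"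
  shows "a \<in> ball_code q ` M"
proof -
  have qM: "q k \<in> M" for k
    using q by auto
  note a = a[unfolded code_cond_def]
  note total = a[THEN conjunct1, THEN spec]
  have "\<forall>m. \<exists>k. ball_bit a k (1 / of_nat (Suc m))"
    and near: "\<And>j k s t. ball_bit a j s \<Longrightarrow> ball_bit a k t \<Longrightarrow> d (q j) (q k) < of_rat s + of_rat t"
    and shrink: "\<And>j r. ball_bit a j r \<longleftrightarrow> (\<exists>k t. ball_bit a k t \<and> d (q k) (q j) + of_rat t < of_rat r)"
    using a[THEN conjunct2] by blast+
  then obtain i where i: "\<And>m. ball_bit a (i m) (1 / of_nat (Suc m))"
    by metis
  have rat: "(of_rat (1 / of_nat (Suc m)) :: real) = 1 / Suc m" for m
    by (simp add: of_rat_divide of_rat_add)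
  define \<epsilon> :: "nat \<Rightarrow> real" where "\<epsilon> m = 1 / Suc m" for m
  have \<epsilon>: "\<epsilon> \<longlonglongrightarrow> 0"
    unfolding \<epsilon>_def by (rule LIMSEQ_Suc) (rule lim_1_over_n)
  have qi: "d (q (i m)) (q (i m')) < \<epsilon> m + \<epsilon> m'" for m m'
    using near[OF i i] by (simp only: rat \<epsilon>_def)
  have anti: "\<epsilon> n \<le> \<epsilon> m" if "m \<le> n" for m n
    using that by (simp add: \<epsilon>_def frac_le)
  have "MCauchy (\<lambda>m. q (i m))"
    unfolding MCauchy_def
  proof (intro conjI allI impI)
    fix e :: real assume "e > 0"
    then obtain N where N: "\<epsilon> N < e / 2"
      using order_tendstoD(2)[OF \<epsilon>, of "e / 2"] by (auto simp: eventually_sequentially)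
    have "d (q (i n)) (q (i n')) < e" if "N \<le> n" "N \<le> n'" for n n'
      using qi[of n n'] anti[OF that(1)] anti[OF that(2)] N by simp
    then show "\<exists>N. \<forall>n n'. N \<le> n \<longrightarrow> N \<le> n' \<longrightarrow> d (q (i n)) (q (i n')) < e"
      by blast
  qed (use qM in auto)
  then obtain y where y: "limitin mtopology (\<lambda>m. q (i m)) y sequentially"
    using complete unfolding mcomplete_def by blast
  then have yM: "y \<in> M"
    by (simp add: limitin_mspace)
  have lim: "(\<lambda>m. d (q (i m)) y) \<longlonglongrightarrow> 0"
    using y unfolding limitin_metric_dist_null by blast
  \<comment> \<open>The limit preserves only the weak inequality; the strictly smaller ball in
    \<open>shrink\<close> gives the strict one in \<open>bit\<close>.\<close>
  have upper: "d y (q k) \<le> of_rat t" if "ball_bit a k t" for k t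
  proof -
    have "d y (q k) \<le> d (q (i m)) y + (\<epsilon> m + of_rat t)" for m
      using near[OF i that, of m] triangle[OF yM qM qM, of k "i m"] commute[of y "q (i m)"]
      unfolding rat \<epsilon>_def by simp
    moreover have "(\<lambda>m. d (q (i m)) y + (\<epsilon> m + of_rat t)) \<longlonglongrightarrow> 0 + (0 + of_rat t)"
      by (intro tendsto_intros lim \<epsilon>)
    ultimately show ?thesis
      using LIMSEQ_le_const[of "\<lambda>m. d (q (i m)) y + (\<epsilon> m + of_rat t)" "0 + (0 + of_rat t)"]
      by fastforce
  qed
  have bit: "ball_bit a j r \<longleftrightarrow> d y (q j) < of_rat r" for j r
  proof
    assume "ball_bit a j r"
    then obtain k t where "ball_bit a k t" "d (q k) (q j) + of_rat t < of_rat r"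
      using shrink by blast
    then show "d y (q j) < of_rat r"
      using upper triangle[OF yM qM qM, of j k] by fastforce
  next
    assume r: "d y (q j) < of_rat r"
    have "(\<lambda>m. d (q (i m)) y + d y (q j) + \<epsilon> m) \<longlonglongrightarrow> 0 + d y (q j) + 0"
      by (intro tendsto_intros lim \<epsilon>)
    then obtain m where m: "d (q (i m)) y + d y (q j) + \<epsilon> m < of_rat r"
      using r order_tendstoD(2)[of _ "0 + d y (q j) + 0" sequentially "of_rat r"]
      by (auto simp: eventually_sequentially)
    then have "d (q (i m)) (q j) + of_rat (1 / of_nat (Suc m)) < of_rat r"
      using triangle[OF qM yM qM, of "i m" j] unfolding rat \<epsilon>_def by simp
    then show "ball_bit a j r"
      using shrink i by blast
  qed
  have "a n = ball_code q y n" for n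
    using total[of n] by (auto simp: ball_code_def bit split: prod.splits)
  then have "a = ball_code q y"
    by blast
  then show ?thesis
    using yM by blast
qed

text \<open>Coordinates tagged \<open>True\<close> give one implication and those tagged
  \<open>False\<close> the converse, so both points lie in the same rational balls. By density a
  small one of these would separate distinct points.\<close>

lemma ball_code_le_imp_eq:
  assumes q: "range q \<subseteq> M" and dense: "\<forall>x\<in>M. \<forall>\<epsilon>>0. \<exists>k. d x (q k) < \<epsilon>"
    and "x \<in> M" "y \<in> M" and le: "\<And>n. ball_code q x n \<le> ball_code q y n"
  shows "x = y"
proof (rule ccontr)
  assume "x \<noteq> y"
  have iff: "d x (q k) < of_rat r \<longleftrightarrow> d y (q k) < of_rat r" for k r
    using le[of "to_nat (k, r, True)"] le[of "to_nat (k, r, False)"]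
    by (auto simp: ball_code_def split: if_splits)
  have "d x y > 0"
    using assms(3,4) \<open>x \<noteq> y\<close> by simp
  then obtain r where r: "0 < r" "r < d x y / 2" "r \<in> \<rat>"
    using Rats_dense_in_real[of 0 "d x y / 2"] by auto
  obtain k where k: "d x (q k) < r"
    using dense[rule_format, OF assms(3) r(1)] by blast
  then have "d y (q k) < r"
    using iff r(3) by (metis Rats_cases)
  moreover have "d x y \<le> d x (q k) + d y (q k)"
    using triangle[of x "q k" y] q assms(3,4) by (auto simp: commute)
  ultimately show False
    using k r(2) by simp
qed

end

text \<open>The set of codes is Borel by \<open>code_cond\<close>. The inverse is measurable because
  rational balls around a dense sequence generate the sigma-algebra and each is read off a single
  coordinate.\<close>

lemma standard_borel_coding:
  assumes "standard_borel Y"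
  obtains e :: "'a \<Rightarrow> baire"
  where "e \<in> Y \<rightarrow>\<^sub>M borel" and "e ` space Y \<in> sets borel" and "\<forall>x k. e x k \<le> 1"
    and "\<forall>x\<in>space Y. \<forall>y\<in>space Y. (\<forall>k. e x k \<le> e y k) \<longrightarrow> x = y"
    and "the_inv_into (space Y) e \<in> restrict_space borel (e ` space Y) \<rightarrow>\<^sub>M Y"
proof (cases "space Y = {}")
  \<comment> \<open>The empty space has no dense sequence; a constant map serves.\<close>
  case True
  show thesis
    by (rule that[of "\<lambda>_ _. 0"]) (auto simp: True measurable_def space_restrict_space)
next
  case False
  obtain T where T: "completely_metrizable_space T" "second_countable T" "topspace T = space Y"
    and sets_Y: "sets Y = sigma_sets (space Y) {U. openin T U}"
    using assms unfolding standard_borel_def by blast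
  obtain M d where "Metric_space M d" and complete: "Metric_space.mcomplete M d"
    and T_eq: "T = Metric_space.mtopology M d"
    using T(1) unfolding completely_metrizable_space_def by blast
  then interpret Metric_space M d
    by simp
  have M: "M = space Y"
    using T(3) T_eq by simp
  obtain C where C: "countable C" "C \<subseteq> M" "T closure_of C = M"
    using second_countable_imp_separable_space[OF T(2)] T(3) M
    by (auto simp: separable_space_def)
  have "C \<noteq> {}"
    using C(3) False M by auto
  define q where "q = from_nat_into C"
  have rq: "range q = C"
    unfolding q_def using C(1) \<open>C \<noteq> {}\<close> by (rule range_from_nat_into[rotated])
  have q: "range q \<subseteq> M"
    using rq C(2) by simp
  have dense: "\<forall>x\<in>M. \<forall>\<epsilon>>0. \<exists>k. d x (q k) < \<epsilon>"
  proof (intro ballI allI impI)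
    fix x \<epsilon> assume "x \<in> M" "\<epsilon> > (0 :: real)"
    have "x \<in> mtopology closure_of C"
      using C(3) T_eq \<open>x \<in> M\<close> by simp
    then obtain c where "c \<in> C" "c \<in> mball x \<epsilon>"
      using \<open>\<epsilon> > 0\<close> unfolding metric_closure_of by blast
    then show "\<exists>k. d x (q k) < \<epsilon>"
      using rq by (auto simp: mball_def)
  qed
  let ?e = "ball_code q"
  let ?ball = "\<lambda>k r. {y \<in> space Y. d y (q k) < of_rat r}"
  have ball: "?ball k r = mball (q k) (of_rat r)" for k r
    using q by (auto simp: M[symmetric] commute[of _ "q k"] range_subsetD)
  have [measurable]: "?ball k r \<in> sets Y" for k r
    using openin_mball[of "q k" "of_rat r"] unfolding ball sets_Y T_eq by (auto intro: sigma_sets.Basic)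
  have "(\<lambda>y. ?e y n) \<in> Y \<rightarrow>\<^sub>M borel" for n
  proof -
    obtain k r s where n: "(from_nat n :: nat \<times> rat \<times> bool) = (k, r, s)"
      by (cases "from_nat n :: nat \<times> rat \<times> bool")
    show ?thesis
      unfolding ball_code_def n by measurable
  qed
  then have e: "?e \<in> Y \<rightarrow>\<^sub>M borel"
    by (rule measurable_coordinatewise_then_product)
  have "?e ` space Y = {a \<in> space borel. code_cond q a}"
    using code_cond_code[OF q dense] code_cond_imp_code[OF q complete] by (auto simp: M)
  also have "\<dots> \<in> sets borel"
    unfolding code_cond_def case_prod_beta by measurable
  finally have img: "?e ` space Y \<in> sets borel" .
  have inj: "inj_on ?e (space Y)"
  proof (rule inj_onI)
    show "x = y" if "x \<in> space Y" "y \<in> space Y" "?e x = ?e y" for x y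
      by (rule ball_code_le_imp_eq[OF q dense]) (use that in \<open>simp_all add: M\<close>)
  qed
  have balls: "U \<in> sigma_sets (space Y) {?ball k r |k r. True}" if U: "openin T U" for U
  proof -
    let ?I = "{(k, r). ?ball k r \<subseteq> U}"
    have "U = (\<Union>(k, r)\<in>?I. ?ball k r)"
    proof (intro equalityI subsetI)
      fix x assume "x \<in> U"
      then obtain \<epsilon> where "\<epsilon> > 0" and \<epsilon>: "mball x \<epsilon> \<subseteq> U" and x: "x \<in> M"
        using U[unfolded T_eq openin_mtopology] by blast
      then obtain r where r: "0 < r" "r < \<epsilon> / 2" "r \<in> \<rat>"
        using Rats_dense_in_real[of 0 "\<epsilon> / 2"] by auto
      then obtain r' where r': "r = of_rat r'"
        using Rats_cases by blast
      obtain k where k: "d x (q k) < r"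
        using dense[rule_format, OF x r(1)] by blast
      have "?ball k r' \<subseteq> mball x \<epsilon>"
      proof
        fix y assume y: "y \<in> ?ball k r'"
        then have "d x y \<le> d x (q k) + d y (q k)"
          using triangle[of x "q k" y] commute[of y "q k"] q x by (simp add: M range_subsetD)
        then show "y \<in> mball x \<epsilon>"
          using y k r x by (simp add: M[symmetric] r')
      qed
      then have "(k, r') \<in> ?I"
        using \<epsilon> by blast
      then show "x \<in> (\<Union>(k, r)\<in>?I. ?ball k r)"
        using k x r' M by (intro UN_I[of "(k, r')"]) auto
    qed auto
    moreover have "(\<Union>(k, r)\<in>?I. ?ball k r) \<in> sigma_sets (space Y) {?ball k r |k r. True}"
    proof (intro sigma_sets_UNION)
      show "B \<in> sigma_sets (space Y) {?ball k r |k r. True}" if "B \<in> (\<lambda>(k, r). ?ball k r) ` ?I" for B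
        using that by (intro sigma_sets.Basic) auto
    qed simp
    ultimately show ?thesis
      by simp
  qed
  have "the_inv_into (space Y) ?e \<in> restrict_space borel (?e ` space Y) \<rightarrow>\<^sub>M sigma (space Y) {?ball k r |k r. True}"
  proof (rule measurable_sigma_sets[OF sets_measure_of])
    show "{?ball k r |k r. True} \<subseteq> Pow (space Y)"
      by auto
    show "the_inv_into (space Y) ?e \<in> space (restrict_space borel (?e ` space Y)) \<rightarrow> space Y"
      using inj by (auto simp: space_restrict_space the_inv_into_f_f)
    fix A assume "A \<in> {?ball k r |k r. True}"
    then obtain k r where A: "A = ?ball k r"
      by blast
    have "the_inv_into (space Y) ?e -` A \<inter> space (restrict_space borel (?e ` space Y)) =
        {a \<in> space borel. ball_bit a k r} \<inter> ?e ` space Y"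
      using inj by (auto simp: A space_restrict_space the_inv_into_f_f)
    moreover have "{a \<in> space borel. ball_bit a k r} \<in> sets borel"
      unfolding ball_bit_def by measurable
    ultimately show "the_inv_into (space Y) ?e -` A \<inter> space (restrict_space borel (?e ` space Y))
        \<in> sets (restrict_space borel (?e ` space Y))"
      using img by (simp add: sets_restrict_space_iff sets.Int)
  qed auto
  moreover have "sets (sigma (space Y) {?ball k r |k r. True}) = sets Y"
  proof -
    have "sets (sigma (space Y) {?ball k r |k r. True}) = sigma_sets (space Y) {?ball k r |k r. True}"
      by (rule sets_measure_of) auto
    also have "\<dots> = sigma_sets (space Y) {U. openin T U}"
    proof (rule sigma_sets_eqI)
      fix A assume "A \<in> {?ball k r |k r. True}"
      then obtain k r where "A = mball (q k) (of_rat r)"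
        unfolding ball by blast
      then show "A \<in> sigma_sets (space Y) {U. openin T U}"
        unfolding T_eq by (intro sigma_sets.Basic) simp
    qed (use balls in simp)
    finally show ?thesis
      unfolding sets_Y .
  qed
  ultimately have "the_inv_into (space Y) ?e \<in> restrict_space borel (?e ` space Y) \<rightarrow>\<^sub>M Y"
    by (simp cong: measurable_cong_sets)
  then show thesis
  proof (rule that[OF e img, rotated 2])
    show "\<forall>x k. ?e x k \<le> 1"
      by (auto simp: ball_code_def split: prod.splits)
    show "\<forall>x\<in>space Y. \<forall>y\<in>space Y. (\<forall>k. ?e x k \<le> ?e y k) \<longrightarrow> x = y"
      using ball_code_le_imp_eq[OF q dense] by (simp add: M)
  qed
qed

text \<open>The inverse of the coding carries the Borel set witnessing analyticity to a Borel set of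
  triples, itself a projection of a closed set; the two projections are merged into one.\<close>

lemma analytic_set_closed_projection:
  fixes e :: "'a \<Rightarrow> baire"
  assumes img: "e ` space Y \<in> sets borel" and inj: "inj_on e (space Y)"
    and inv: "the_inv_into (space Y) e \<in> restrict_space borel (e ` space Y) \<rightarrow>\<^sub>M Y"
    and R: "analytic_set (Y \<Otimes>\<^sub>M Y) R"
  obtains F :: "(baire \<times> baire \<times> baire) set" where "closed F"
    and "\<forall>a b. (\<exists>w. (a, b, w) \<in> F) \<longleftrightarrow> (\<exists>x y. (x, y) \<in> R \<and> a = e x \<and> b = e y)"
proof -
  obtain B where B: "B \<in> sets ((Y \<Otimes>\<^sub>M Y) \<Otimes>\<^sub>M (borel :: baire measure))" and RB: "R = fst ` B"
    using R unfolding analytic_set_def by blast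
  have B_sub: "B \<subseteq> (space Y \<times> space Y) \<times> UNIV"
    using sets.sets_into_space[OF B] by (simp add: space_pair_measure)
  let ?E = "e ` space Y"
  let ?N = "restrict_space (borel :: (baire \<times> baire \<times> baire) measure) (?E \<times> ?E \<times> UNIV)"
  let ?f = "\<lambda>(a, b, \<eta>). ((the_inv_into (space Y) e a, the_inv_into (space Y) e b), \<eta> :: baire)"
  have dom: "?E \<times> ?E \<times> UNIV \<in> sets (borel :: (baire \<times> baire \<times> baire) measure)"
    using img by (simp add: borel_prod[symmetric])
  have f: "?f \<in> ?N \<rightarrow>\<^sub>M (Y \<Otimes>\<^sub>M Y) \<Otimes>\<^sub>M borel"
  proof -
    have "fst \<in> ?N \<rightarrow>\<^sub>M restrict_space borel ?E"
      by (rule measurable_restrict_space3) (auto simp: borel_prod[symmetric])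
    moreover have "(\<lambda>p. fst (snd p)) \<in> ?N \<rightarrow>\<^sub>M restrict_space borel ?E"
      by (rule measurable_restrict_space3) (auto simp: borel_prod[symmetric])
    moreover have "(\<lambda>p. snd (snd p)) \<in> ?N \<rightarrow>\<^sub>M borel"
      by (rule measurable_restrict_space1) (simp add: borel_prod[symmetric])
    ultimately show ?thesis
      unfolding case_prod_beta
      by (intro measurable_Pair measurable_compose[OF _ inv])
  qed
  define B' where "B' = ?f -` B \<inter> space ?N"
  have "B' \<in> sets ?N"
    unfolding B'_def using f B by (rule measurable_sets)
  then have "B' \<in> sets borel"
    using dom by (simp add: sets_restrict_space_iff)
  moreover have "metrizable_space (euclidean :: (baire \<times> baire \<times> baire) topology)"
    by (intro completely_metrizable_imp_metrizable_space completely_metrizable_space_prod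
        completely_metrizable_space_fun completely_metrizable_space_discrete)
  ultimately have "souslin B'"
    by (intro borel_imp_souslin)
  then obtain F :: "((baire \<times> baire \<times> baire) \<times> baire) set" where F: "closed F" "B' = fst ` F"
    unfolding souslin_def by blast
  have inv_e: "the_inv_into (space Y) e (e x) = x" if "x \<in> space Y" for x
    using inj that by (rule the_inv_into_f_f)
  have B': "(a, b, \<eta>) \<in> B' \<longleftrightarrow> (\<exists>x y. ((x, y), \<eta>) \<in> B \<and> a = e x \<and> b = e y)" for a b \<eta>
  proof
    assume "(a, b, \<eta>) \<in> B'"
    then obtain x y where "x \<in> space Y" "y \<in> space Y" "a = e x" "b = e y" "?f (a, b, \<eta>) \<in> B"
      by (auto simp: B'_def space_restrict_space)
    then show "\<exists>x y. ((x, y), \<eta>) \<in> B \<and> a = e x \<and> b = e y"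
      using inv_e by auto
  next
    assume "\<exists>x y. ((x, y), \<eta>) \<in> B \<and> a = e x \<and> b = e y"
    then obtain x y where "((x, y), \<eta>) \<in> B" "a = e x" "b = e y"
      by blast
    moreover from this have "x \<in> space Y" "y \<in> space Y"
      using B_sub by auto
    ultimately show "(a, b, \<eta>) \<in> B'"
      using inv_e by (simp add: B'_def space_restrict_space)
  qed
  \<comment> \<open>Even entries of \<open>w\<close> witness the projection of \<open>B\<close>, odd
    entries that of the closed set \<open>F\<close>.\<close>
  define G where "G = (\<lambda>(a, b, w :: baire). ((a, b, \<lambda>i. w (2 * i)), \<lambda>i. w (Suc (2 * i)))) -` F"
  show thesis
  proof (rule that[of G])
    show "closed G"
      unfolding G_def case_prod_beta
      by (intro closed_vimage F(1) continuous_intros continuous_on_product_then_coordinatewise)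
    show "\<forall>a b. (\<exists>w. (a, b, w) \<in> G) \<longleftrightarrow> (\<exists>x y. (x, y) \<in> R \<and> a = e x \<and> b = e y)"
    proof (intro allI)
      fix a b
      have "(\<exists>w. (a, b, w) \<in> G) \<longleftrightarrow> (\<exists>\<eta> \<xi>. ((a, b, \<eta>), \<xi>) \<in> F)"
      proof
        assume "\<exists>\<eta> \<xi>. ((a, b, \<eta>), \<xi>) \<in> F"
        then obtain \<eta> \<xi> where "((a, b, \<eta>), \<xi>) \<in> F"
          by blast
        then have "(a, b, \<lambda>i. if even i then \<eta> (i div 2) else \<xi> (i div 2)) \<in> G"
          by (simp add: G_def)
        then show "\<exists>w. (a, b, w) \<in> G"
          by blast
      qed (auto simp: G_def)
      also have "\<dots> \<longleftrightarrow> (\<exists>\<eta>. (a, b, \<eta>) \<in> B')"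
        unfolding F(2) by force
      also have "\<dots> \<longleftrightarrow> (\<exists>x y. (x, y) \<in> R \<and> a = e x \<and> b = e y)"
        unfolding B' RB by force
      finally show "(\<exists>w. (a, b, w) \<in> G) \<longleftrightarrow> (\<exists>x y. (x, y) \<in> R \<and> a = e x \<and> b = e y)" .
    qed
  qed
qed

section \<open>The coloured orders\<close>

lemma append_less_append_iff [simp]: "xs @ ys < xs @ zs \<longleftrightarrow> ys < (zs :: 'a::order list)"
  by (induction xs) auto

lemma append_le_append_iff [simp]: "xs @ ys \<le> xs @ zs \<longleftrightarrow> ys \<le> (zs :: 'a::order list)"
  by (induction xs) auto

text \<open>This confines order intervals to one subtree, both when following an embedding and when
  counting points.\<close>

lemma between_siblings:
  fixes q :: "'a::linorder list"
  assumes "q @ [a] \<le> t" "t < q @ [b]"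
  obtains c r where "t = q @ c # r" "a \<le> c" "c < b"
proof -
  have "\<exists>c r. t = q @ c # r \<and> a \<le> c \<and> c < b"
    using assms
  proof (induction q arbitrary: t)
    case Nil
    then show ?case
      by (cases t) auto
  next
    case (Cons x q)
    then show ?case
      by (cases t) auto
  qed
  then show thesis
    using that by blast
qed

text \<open>The factor \<open>2\<close> keeps the parities while the halves grow by
  \<open>\<alpha>\<close>.\<close>

primrec shift :: "baire \<Rightarrow> nat list \<Rightarrow> nat list" where
  "shift \<alpha> [] = []"
| "shift \<alpha> (i # r) = (i + 2 * \<alpha> 0) # shift (\<lambda>k. \<alpha> (Suc k)) r"

lemma length_shift [simp]: "length (shift \<alpha> r) = length r"
  by (induction r arbitrary: \<alpha>) auto

lemma nth_shift [simp]: "k < length r \<Longrightarrow> shift \<alpha> r ! k = r ! k + 2 * \<alpha> k"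
  by (induction r arbitrary: \<alpha> k) (auto simp: nth_Cons split: nat.splits)

lemma butlast_shift: "butlast (shift \<alpha> r) = shift \<alpha> (butlast r)"
  by (rule nth_equalityI) (auto simp: nth_butlast)

lemma shift_less: "r < r' \<Longrightarrow> shift \<alpha> r < shift \<alpha> r'"
proof (induction r arbitrary: \<alpha> r')
  case Nil
  then show ?case by (cases r') auto
next
  case (Cons i r)
  then show ?case by (cases r') auto
qed

section \<open>The tree, the points and the colours attached to a sequence\<close>

definition nodes :: "(baire \<times> baire \<times> baire) set \<Rightarrow> baire \<Rightarrow> nat list set" where
  "nodes F a = {p. link F (length p) (\<lambda>k. p ! k div 2) (\<lambda>k. p ! k mod 2) a}"

text \<open>The last entry is unrestricted, so directly below each node there is a sequence of
  points of type omega.\<close>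

definition points :: "(baire \<times> baire \<times> baire) set \<Rightarrow> baire \<Rightarrow> nat list set" where
  "points F a = {r. r \<noteq> [] \<and> butlast r \<in> nodes F a}"

text \<open>Twice the level plus the last bit of the node \<open>butlast r\<close>, with bit
  \<open>0\<close> for the empty node. A map that does not raise colours cannot raise the level, nor
  the bit if the level stays the same.\<close>

definition colour :: "nat list \<Rightarrow> nat" where
  "colour r = 2 * (length r - 1) + (if length r \<ge> 2 then r ! (length r - 2) mod 2 else 0)"

lemma colour_div_2 [simp]: "colour r div 2 = length r - 1"
  by (simp add: colour_def)

lemma colour_snoc_snoc [simp]: "colour (p @ [i, j]) = 2 * Suc (length p) + i mod 2"
  by (simp add: colour_def nth_append)

lemma snoc_in_points [simp]: "p @ [i] \<in> points F a \<longleftrightarrow> p \<in> nodes F a"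
  by (simp add: points_def)

lemma nodes_take:
  assumes "p \<in> nodes F a"
  shows "take k p \<in> nodes F a"
proof -
  have "link F (length (take k p)) (\<lambda>k. p ! k div 2) (\<lambda>k. p ! k mod 2) a"
    using assms unfolding nodes_def by (auto intro: link_mono)
  then have "link F (length (take k p)) (\<lambda>j. take k p ! j div 2) (\<lambda>j. take k p ! j mod 2) a"
    by (rule link_cong) simp
  then show ?thesis
    by (simp add: nodes_def)
qed

lemma take_in_points:
  assumes "r \<in> points F a" "0 < k"
  shows "take k r \<in> points F a"
proof (cases "k < length r")
  case True
  then have "butlast (take k r) = take (k - 1) (butlast r)"
    by (simp add: butlast_take take_butlast)
  then show ?thesis
    using assms nodes_take by (auto simp: points_def)
qed (use assms in simp)

lemma sibling_in_points:
  assumes "r \<in> points F a" "k < length r"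
  shows "take k r @ [j] \<in> points F a"
proof -
  have "take k r = take k (butlast r)"
    using assms(2) by (simp add: take_butlast)
  then show ?thesis
    using assms nodes_take by (auto simp: points_def)
qed

text \<open>By reflexivity of \<open>link\<close>, along the bits of \<open>a\<close> the halves of
  the entries are arbitrary; this lets the descent below choose large entries.\<close>

lemma nodes_bits:
  assumes "\<And>k. a k \<le> 1" "\<And>k. k < length p \<Longrightarrow> p ! k mod 2 = a k"
  shows "p \<in> nodes F a"
proof -
  have "link F (length p) (\<lambda>k. p ! k div 2) a a"
    by (rule link_refl) (rule assms)
  then have "link F (length p) (\<lambda>k. p ! k div 2) (\<lambda>k. p ! k mod 2) a"
    by (rule link_cong) (use assms(2) in simp)
  then show ?thesis
    by (simp add: nodes_def)
qed

text \<open>The chain length \<open>[] ! 0 div 2\<close> is unspecified, but at level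
  \<open>0\<close> every condition is vacuous.\<close>

lemma Nil_in_nodes: "[] \<in> nodes F a"
  unfolding nodes_def link_def by (auto intro!: exI[of _ "\<lambda>_ _. 0"])

lemma infinite_points: "infinite (points F a)"
proof -
  have "range (\<lambda>i. [i]) \<subseteq> points F a"
    by (auto simp: points_def Nil_in_nodes)
  moreover have "infinite (range (\<lambda>i::nat. [i]))"
    by (intro range_inj_infinite injI) simp
  ultimately show ?thesis
    by (rule infinite_super)
qed

text \<open>The chain of the node is extended by the chain of \<open>link_step\<close>; since bounds
  add, the new bound is the half of the shifted node.\<close>

lemma shift_in_points:
  assumes "(a, b, w) \<in> F" "\<And>k. a k \<le> 1" "\<And>k. b k \<le> 1" and r: "r \<in> points F a"
  shows "shift (\<lambda>k. Suc (w k)) r \<in> points F b"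
proof -
  let ?p = "butlast r"
  have "link F (length ?p) (\<lambda>k. ?p ! k div 2) (\<lambda>k. ?p ! k mod 2) a"
    using r by (simp add: points_def nodes_def)
  from link_trans[OF this link_step[OF assms(1-3)]]
  have "link F (length ?p) (\<lambda>k. ?p ! k div 2 + Suc (w k)) (\<lambda>k. ?p ! k mod 2) b" .
  then have "link F (length ?p) (\<lambda>k. shift (\<lambda>k. Suc (w k)) ?p ! k div 2)
      (\<lambda>k. shift (\<lambda>k. Suc (w k)) ?p ! k mod 2) b"
    by (rule link_cong) simp
  then have "shift (\<lambda>k. Suc (w k)) ?p \<in> nodes F b"
    by (simp add: nodes_def)
  moreover have "shift (\<lambda>k. Suc (w k)) r \<noteq> []"
    using r by (cases r) (auto simp: points_def)
  ultimately show ?thesis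
    by (simp add: points_def butlast_shift)
qed

lemma colour_shift: "colour (shift \<alpha> r) = colour r"
  by (simp add: colour_def)

section \<open>From embeddings to branches\<close>

lemma eventually_const_of_bounded_mono:
  fixes c :: "nat \<Rightarrow> nat"
  assumes "\<And>i j. i \<le> j \<Longrightarrow> c i \<le> c j" "\<And>i. c i < b"
  obtains N where "\<And>j. N \<le> j \<Longrightarrow> c j = c N"
proof -
  have fin: "finite (range c)"
    by (rule finite_subset[of _ "{..<b}"]) (use assms(2) in auto)
  then obtain N where N: "c N = Max (range c)"
    using Max_in[OF fin] by (metis (no_types) UNIV_not_empty image_is_empty imageE)
  have "c j = c N" if "N \<le> j" for j
    using assms(1)[OF that] Max_ge[OF fin, of "c j"] N by simp
  then show thesis
    by (rule that)
qed

text \<open>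
  An increasing map between the orders that does not raise colours sends the points directly below
  \<open>p\<close>, from some index on, directly below a single node \<open>q\<close>: the points below a child of \<open>p\<close> land
  between two points below \<open>q\<close>, where only finitely many points have the colour of these two.
\<close>
lemma branch_of_embedding:
  assumes a: "\<And>k. a k \<le> 1"
    and G: "\<And>r. r \<in> points F a \<Longrightarrow> G r \<in> points F b"
    and mono: "\<And>r r'. r \<in> points F a \<Longrightarrow> r' \<in> points F a \<Longrightarrow> r < r' \<Longrightarrow> G r < G r'"
    and colour: "\<And>r. r \<in> points F a \<Longrightarrow> colour (G r) \<le> colour r"
  obtains s v where "\<And>k. v k \<le> a k" "\<And>n. link F n s v b"
proof -
  \<comment> \<open>A stage pairs a node \<open>p\<close> with the bits of \<open>a\<close> and a
    node \<open>q\<close> of the other tree at the same level; from \<open>N\<close> on, the points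
    directly below \<open>p\<close> go directly below \<open>q\<close>.\<close>
  define descent where "descent n = (\<lambda>(p, q, N). length p = n \<and> length q = n \<and>
      (\<forall>k<n. p ! k mod 2 = a k \<and> q ! k mod 2 \<le> a k) \<and> q \<in> nodes F b \<and>
      (\<forall>i\<ge>N. \<exists>j. G (p @ [i]) = q @ [j]))" for n :: nat
  have node: "p \<in> nodes F a" if "\<forall>k<length p. p ! k mod 2 = a k" for p
    by (rule nodes_bits[OF a]) (use that in auto)
  have "\<exists>f. \<forall>n. descent n (f n) \<and> (\<exists>c. fst (snd (f (Suc n))) = fst (snd (f n)) @ [c])"
  proof (rule dependent_nat_choice)
    \<comment> \<open>The points \<open>[i]\<close> have colour \<open>0\<close>, which forces their
      images to have length one.\<close>
    have "\<exists>j. G [i] = [j]" for i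
    proof -
      have "[i] \<in> points F a"
        using Nil_in_nodes by (simp add: points_def)
      from colour[OF this] G[OF this] have "colour (G [i]) = 0" "G [i] \<noteq> []"
        by (auto simp: colour_def points_def)
      then have "length (G [i]) = 1"
        using colour_div_2[of "G [i]"] by (cases "G [i]") auto
      then show ?thesis
        by (auto simp: length_Suc_conv)
    qed
    then show "\<exists>x. descent 0 x"
      by (intro exI[of _ "([], [], 0)"]) (simp add: descent_def Nil_in_nodes)
  next
    fix X n assume X: "descent n X"
    define p q N where "p = fst X" and "q = fst (snd X)" and "N = snd (snd X)"
    then have Xpq: "X = (p, q, N)"
      by simp
    have len: "length p = n" "length q = n"
      and bits: "\<And>k. k < n \<Longrightarrow> p ! k mod 2 = a k" "\<And>k. k < n \<Longrightarrow> q ! k mod 2 \<le> a k"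
      and q: "q \<in> nodes F b" and tail: "\<And>i. N \<le> i \<Longrightarrow> \<exists>j. G (p @ [i]) = q @ [j]"
      using X unfolding Xpq descent_def by auto
    \<comment> \<open>The new entry has the parity \<open>a n\<close>, and both \<open>i\<close> and
      \<open>Suc i\<close> lie in the tail where images are known.\<close>
    define i where "i = 2 * N + a n"
    define p' where "p' = p @ [i]"
    have i: "N \<le> i" "i mod 2 = a n"
      using a[of n] by (auto simp: i_def)
    have p': "p' \<in> nodes F a" "p \<in> nodes F a"
      using bits i len by (auto intro!: node simp: p'_def nth_append less_Suc_eq)
    obtain x y where x: "G (p @ [i]) = q @ [x]" and y: "G (p @ [Suc i]) = q @ [y]"
      using tail i(1) by (meson le_SucI)
    have "\<exists>c r. G (p' @ [j]) = q @ c # r \<and> c < y" for j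
    proof -
      have "G (p @ [i]) < G (p' @ [j])" "G (p' @ [j]) < G (p @ [Suc i])"
        using p' by (auto intro!: mono simp: p'_def[symmetric]) (auto simp: p'_def)
      then show ?thesis
        using between_siblings[of q x "G (p' @ [j])" y] unfolding x y by (metis less_imp_le)
    qed
    then obtain c r where Gcr: "\<And>j. G (p' @ [j]) = q @ c j # r j" and cy: "\<And>j. c j < y"
      by metis
    have G_less: "c j # r j < c j' # r j'" if "j < j'" for j j'
      using mono[of "p' @ [j]" "p' @ [j']"] that p' by (simp add: Gcr)
    \<comment> \<open>Not raising colours bounds the level of the image by \<open>Suc n\<close>,
      which leaves at most one entry after \<open>c j\<close>.\<close>
    have short: "length (r j) \<le> 1" for j
    proof -
      have "2 * (n + length (r j)) \<le> colour (G (p' @ [j]))"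
        by (simp add: Gcr colour_def len)
      also have "\<dots> \<le> colour (p' @ [j])"
        using p' by (intro colour) simp
      also have "\<dots> \<le> 2 * Suc n + 1"
        by (simp add: p'_def len)
      finally show ?thesis
        by simp
    qed
    have "c j \<le> c j'" if "j \<le> j'" for j j'
      using G_less[of j j'] that by (cases "j = j'") auto
    then obtain N1 where N1: "\<And>j. N1 \<le> j \<Longrightarrow> c j = c N1"
      using eventually_const_of_bounded_mono[of c y] cy by blast
    \<comment> \<open>Once \<open>c\<close> is constant the remainders strictly increase, so only
      the first of them can be empty.\<close>
    have r1: "\<exists>j'. r j = [j']" if "Suc N1 \<le> j" for j
    proof -
      have "r N1 < r j"
        using G_less[of N1 j] N1[of j] that by auto
      then have "r j \<noteq> []"
        by auto
      then show ?thesis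
        using short[of j] by (cases "r j") auto
    qed
    define q' where "q' = q @ [c N1]"
    have tail': "\<exists>j'. G (p' @ [j]) = q' @ [j']" if "Suc N1 \<le> j" for j
      using r1[OF that] N1[of j] that by (auto simp: Gcr q'_def)
    then obtain j' where j': "G (p' @ [Suc N1]) = q' @ [j']"
      by blast
    have "q' \<in> nodes F b"
      using G[of "p' @ [Suc N1]"] p' by (simp add: j')
    \<comment> \<open>Point and image now have the same level, so their colours compare the last
      bits of their nodes.\<close>
    moreover have "c N1 mod 2 \<le> a n"
      using colour[of "p' @ [Suc N1]"] p' i(2) by (simp add: j') (simp add: p'_def q'_def len)
    ultimately have "descent (Suc n) (p', q', Suc N1)"
      using tail' bits i len by (auto simp: descent_def p'_def q'_def nth_append less_Suc_eq)
    then show "\<exists>Y. descent (Suc n) Y \<and> (\<exists>c. fst (snd Y) = fst (snd X) @ [c])"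
      by (intro exI[of _ "(p', q', Suc N1)"]) (simp add: q'_def Xpq)
  qed
  then obtain f where f: "\<And>n. descent n (f n)" "\<And>n. \<exists>c. fst (snd (f (Suc n))) = fst (snd (f n)) @ [c]"
    by blast
  \<comment> \<open>The nodes \<open>q n\<close> form one branch; its halves become the bound
    \<open>s\<close> and its parities the sequence \<open>v\<close>.\<close>
  define q where "q n = fst (snd (f n))" for n
  have q: "length (q n) = n" "\<And>k. k < n \<Longrightarrow> q n ! k mod 2 \<le> a k" "q n \<in> nodes F b" for n
    using f(1)[of n] by (auto simp: descent_def q_def split: prod.splits)
  have q_nth: "k < n \<Longrightarrow> q n ! k = q (Suc k) ! k" for n k
  proof (induction n)
    case (Suc n)
    obtain c where "q (Suc n) = q n @ [c]"
      using f(2)[of n] by (auto simp: q_def)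
    then show ?case
      using Suc by (cases "k = n") (auto simp: nth_append q(1))
  qed simp
  show thesis
  proof
    show "q (Suc k) ! k mod 2 \<le> a k" for k
      by (rule q(2)) simp
    show "link F n (\<lambda>k. q (Suc k) ! k div 2) (\<lambda>k. q (Suc k) ! k mod 2) b" for n
    proof -
      have "link F n (\<lambda>k. q n ! k div 2) (\<lambda>k. q n ! k mod 2) b"
        using q(3)[of n] q(1)[of n] by (simp add: nodes_def)
      then show ?thesis
        by (rule link_cong) (simp add: q_nth[where n = n])
    qed
  qed
qed

section \<open>Realising sets of sequences as coloured orders on the natural numbers\<close>

definition enum :: "nat list set \<Rightarrow> nat \<Rightarrow> nat list" where
  "enum S n = from_nat (enumerate (to_nat ` S) n)"

lemma bij_enum:
  assumes "infinite S"
  shows "bij_betw (enum S) UNIV S"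
proof -
  have "infinite (to_nat ` S)"
    using assms finite_imageD[OF _ inj_on_subset[OF inj_to_nat subset_UNIV]] by blast
  then have 1: "bij_betw (enumerate (to_nat ` S)) UNIV (to_nat ` S)"
    by (rule bij_enumerate)
  have 2: "bij_betw (from_nat :: nat \<Rightarrow> nat list) (to_nat ` S) S"
    by (rule bij_betwI[where g = to_nat]) auto
  have "enum S = from_nat \<circ> enumerate (to_nat ` S)"
    by (simp add: enum_def fun_eq_iff)
  then show ?thesis
    using bij_betw_trans[OF 1 2] by simp
qed

lemma enum_in: "infinite S \<Longrightarrow> enum S n \<in> S"
  using bij_enum bij_betwE by blast

lemma enum_eq_iff: "infinite S \<Longrightarrow> enum S m = enum S n \<longleftrightarrow> m = n"
  using bij_enum by (metis UNIV_I bij_betw_iff_bijections)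

lemma enum_surj:
  assumes "infinite S" "r \<in> S"
  obtains n where "r = enum S n"
  using bij_enum[OF assms(1)] assms(2) by (auto simp: bij_betw_def)

definition colored_enum :: "nat list set \<Rightarrow> colored_order" where
  "colored_enum S = ((\<lambda>(m, n). enum S m < enum S n), (\<lambda>n. colour (enum S n)))"

lemma colored_enum_LO: "infinite S \<Longrightarrow> fst (colored_enum S) \<in> LO"
  by (auto simp: colored_enum_def LO_def strict_linear_order_on_def total_on_def
      enum_eq_iff[symmetric] intro!: transI irreflI)

text \<open>Replaces maps of indices by maps of sequences. Between linear orders a strictly
  increasing map is injective and reflects the order.\<close>

lemma colored_emb_enum_iff:
  assumes S: "infinite S" "infinite S'"
  shows "(colored_enum S, colored_enum S') \<in> colored_emb R \<longleftrightarrow>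
    (\<exists>G. (\<forall>r\<in>S. G r \<in> S' \<and> (colour r, colour (G r)) \<in> R) \<and> (\<forall>r\<in>S. \<forall>r'\<in>S. r < r' \<longrightarrow> G r < G r'))"
proof
  assume "(colored_enum S, colored_enum S') \<in> colored_emb R"
  then obtain g where g: "\<And>m n. enum S m < enum S n \<longleftrightarrow> enum S' (g m) < enum S' (g n)"
    "\<And>n. (colour (enum S n), colour (enum S' (g n))) \<in> R"
    by (auto simp: colored_emb_def colored_enum_def order_embedding_def)
  define G where "G r = enum S' (g (inv (enum S) r))" for r
  have G: "G (enum S n) = enum S' (g n)" for n
    using S(1) by (simp add: G_def inv_f_f inj_def enum_eq_iff)
  show "\<exists>G. (\<forall>r\<in>S. G r \<in> S' \<and> (colour r, colour (G r)) \<in> R) \<and> (\<forall>r\<in>S. \<forall>r'\<in>S. r < r' \<longrightarrow> G r < G r')"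
    by (intro exI[of _ G] conjI ballI impI)
       (use g S in \<open>auto simp: G enum_in elim!: enum_surj[OF S(1)]\<close>)
next
  assume "\<exists>G. (\<forall>r\<in>S. G r \<in> S' \<and> (colour r, colour (G r)) \<in> R) \<and> (\<forall>r\<in>S. \<forall>r'\<in>S. r < r' \<longrightarrow> G r < G r')"
  then obtain G where G: "\<And>r. r \<in> S \<Longrightarrow> G r \<in> S'" "\<And>r. r \<in> S \<Longrightarrow> (colour r, colour (G r)) \<in> R"
    and mono: "\<And>r r'. r \<in> S \<Longrightarrow> r' \<in> S \<Longrightarrow> r < r' \<Longrightarrow> G r < G r'"
    by blast
  have iff: "r < r' \<longleftrightarrow> G r < G r'" "G r = G r' \<longleftrightarrow> r = r'" if "r \<in> S" "r' \<in> S" for r r'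
    using mono[OF that] mono[OF that(2,1)] by (metis less_asym less_irrefl linorder_neqE)+
  have "\<exists>m. enum S' m = G (enum S n)" for n
    using enum_surj[OF S(2) G(1)[OF enum_in[OF S(1)]]] by metis
  then obtain g where g: "\<And>n. enum S' (g n) = G (enum S n)"
    by metis
  have "order_embedding (fst (colored_enum S)) (fst (colored_enum S')) g"
    unfolding order_embedding_def
  proof (intro conjI allI injI)
    show "m = n" if "g m = g n" for m n
      using that g[of m] g[of n] iff(2)[of "enum S m" "enum S n"] S(1) by (simp add: enum_in enum_eq_iff)
    show "fst (colored_enum S) (m, n) \<longleftrightarrow> fst (colored_enum S') (g m, g n)" for m n
      using iff(1)[of "enum S m" "enum S n"] S(1) by (simp add: colored_enum_def g enum_in)
  qed
  moreover have "\<forall>n. (snd (colored_enum S) n, snd (colored_enum S') (g n)) \<in> R"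
    using G(2) S(1) by (simp add: colored_enum_def g enum_in)
  ultimately show "(colored_enum S, colored_enum S') \<in> colored_emb R"
    using colored_enum_LO[OF S(1)] colored_enum_LO[OF S(2)]
    unfolding colored_emb_def by (auto simp: case_prod_beta)
qed

section \<open>Rigidity and decoding\<close>

text \<open>
  The \<open>k\<close>-th entry of a point counts the points of level \<open>k\<close> not above it that are separated from it
  by no point of smaller level. This recovers the sequences from the coloured order alone.
\<close>
definition entry_card :: "colored_order \<Rightarrow> nat \<Rightarrow> nat \<Rightarrow> nat" where
  "entry_card x n k = card {m. snd x m div 2 = k \<and> (m = n \<or> fst x (m, n)) \<and>
     \<not> (\<exists>l. fst x (m, l) \<and> (l = n \<or> fst x (l, n)) \<and> snd x l div 2 < k)}"

text \<open>Siblings with last entry from \<open>0\<close> to \<open>r ! k\<close> are counted,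
  whence \<open>Suc\<close>; an infinite count has \<open>card\<close> zero and is never
  read.\<close>

definition reads :: "colored_order \<Rightarrow> nat \<Rightarrow> nat list \<Rightarrow> bool" where
  "reads x n r \<longleftrightarrow>
     length r = Suc (snd x n div 2) \<and> (\<forall>k<length r. Suc (r ! k) = entry_card x n k)"

lemma reads_unique:
  assumes "reads x n r" "reads x n r'"
  shows "r = r'"
proof (rule nth_equalityI)
  show "length r = length r'"
    using assms by (simp add: reads_def)
  fix k assume "k < length r"
  then have "Suc (r ! k) = Suc (r' ! k)"
    using assms by (simp add: reads_def)
  then show "r ! k = r' ! k"
    by simp
qed

text \<open>\<open>entry_card\<close> is built from the order and the levels alone, so isomorphisms
  transport it.\<close>

lemma reads_iso:
  assumes g: "bij g" "\<And>m n. fst x (m, n) \<longleftrightarrow> fst y (g m, g n)" "\<And>n. snd x n = snd y (g n)"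
  shows "reads y (g n) r \<longleftrightarrow> reads x n r"
proof -
  have surj: "\<exists>m. j = g m" for j
    using bij_is_surj[OF g(1)] by (rule surjD)
  then have ex: "(\<exists>l. P l) \<longleftrightarrow> (\<exists>l. P (g l))" for P
    by metis
  have eq: "g m = g n \<longleftrightarrow> m = n" for m n
    using g(1) by (simp add: bij_is_inj inj_eq)
  have "entry_card y (g n) k = entry_card x n k" for k
  proof -
    have "{m. snd y m div 2 = k \<and> (m = g n \<or> fst y (m, g n)) \<and>
        \<not> (\<exists>l. fst y (m, l) \<and> (l = g n \<or> fst y (l, g n)) \<and> snd y l div 2 < k)} =
      g ` {m. snd x m div 2 = k \<and> (m = n \<or> fst x (m, n)) \<and>
        \<not> (\<exists>l. fst x (m, l) \<and> (l = n \<or> fst x (l, n)) \<and> snd x l div 2 < k)}" (is "?A = g ` ?B")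
    proof -
      have "g m \<in> ?A \<longleftrightarrow> m \<in> ?B" for m
        unfolding mem_Collect_eq
          ex[of "\<lambda>l. fst y (g m, l) \<and> (l = g n \<or> fst y (l, g n)) \<and> snd y l div 2 < k"]
        by (simp add: g(2,3) eq)
      then have "g -` ?A = ?B"
        by (intro set_eqI) simp
      moreover have "?A = g ` (g -` ?A)"
        by (rule surj_image_vimage_eq[OF bij_is_surj[OF g(1)], symmetric])
      ultimately show ?thesis
        by (simp only:)
    qed
    then show ?thesis
      unfolding entry_card_def
      by (simp add: card_image inj_on_subset[OF bij_is_inj[OF g(1)] subset_UNIV])
  qed
  then show ?thesis
    by (simp add: reads_def g(3))
qed

text \<open>In the second alternative a prefix of \<open>z\<close> of level below \<open>k\<close>
  separates \<open>w\<close> from \<open>z\<close>, which excludes \<open>w\<close> from the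
  count.\<close>

lemma le_same_level:
  fixes w z :: "nat list"
  assumes "w \<le> z" "length w = Suc k" "k < length z"
  shows "(\<exists>j\<le>z ! k. w = take k z @ [j]) \<or> (\<exists>m<k. w < take (Suc m) z)"
  using assms
proof (induction k arbitrary: w z)
  case 0
  then show ?case
    by (cases z) (auto simp: length_Suc_conv)
next
  case (Suc k)
  obtain x w' y z' where wz: "w = x # w'" "z = y # z'"
    using Suc.prems by (cases w; cases z) auto
  show ?case
  proof (cases "x = y")
    case True
    then have "(\<exists>j\<le>z' ! k. w' = take k z' @ [j]) \<or> (\<exists>m<k. w' < take (Suc m) z')"
      using Suc.prems wz by (intro Suc.IH) auto
    then show ?thesis
      using True wz by fastforce
  next
    case False
    then have "w < take (Suc 0) z"
      using Suc.prems wz by auto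
    then show ?thesis
      by blast
  qed
qed

lemma prefix_le: "take k z \<le> (z :: nat list)"
proof -
  have "take k z @ [] \<le> take k z @ drop k z"
    unfolding append_le_append_iff by simp
  then show ?thesis
    by simp
qed

text \<open>The points counted for entry \<open>k\<close> are the siblings
  \<open>take k z @ [j]\<close> with \<open>j \<le> z ! k\<close>: by \<open>le_same_level\<close>
  all other candidates are separated from \<open>z\<close> by a prefix of \<open>z\<close>.\<close>

lemma reads_enum:
  fixes F a
  defines "S \<equiv> points F a"
  shows "reads (colored_enum S) n (enum S n)"
proof -
  have inf: "infinite S"
    by (simp add: S_def infinite_points)
  define z where "z = enum S n"
  have z: "z \<in> S"
    using inf by (simp add: z_def enum_in)
  have pos: "0 < length w" if "w \<in> S" for w
    using that by (auto simp: S_def points_def)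
  have "entry_card (colored_enum S) n k = Suc (z ! k)" if k: "k < length z" for k
  proof -
    let ?A = "{m. snd (colored_enum S) m div 2 = k \<and> (m = n \<or> fst (colored_enum S) (m, n)) \<and>
      \<not> (\<exists>l. fst (colored_enum S) (m, l) \<and> (l = n \<or> fst (colored_enum S) (l, n)) \<and>
          snd (colored_enum S) l div 2 < k)}"
    let ?B = "{w \<in> S. length w = Suc k \<and> w \<le> z \<and> \<not> (\<exists>w'\<in>S. w < w' \<and> w' \<le> z \<and> length w' \<le> k)}"
    have le: "m = n \<or> fst (colored_enum S) (m, n) \<longleftrightarrow> enum S m \<le> z" for m
      using inf by (auto simp: colored_enum_def z_def le_less enum_eq_iff)
    have len: "length w - Suc 0 = k \<longleftrightarrow> length w = Suc k" "length w - Suc 0 < k \<longleftrightarrow> length w \<le> k" if "w \<in> S" for w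
      using pos[OF that] by linarith+
    have S_ex: "(\<exists>w'\<in>S. P w') \<longleftrightarrow> (\<exists>l. P (enum S l))" for P
      using enum_in[OF inf] enum_surj[OF inf] by metis
    have mem: "m \<in> ?A \<longleftrightarrow> enum S m \<in> ?B" for m
      unfolding mem_Collect_eq le S_ex
      by (simp add: colored_enum_def len[OF enum_in[OF inf]] enum_in[OF inf])
    have "?B = enum S ` ?A"
    proof (intro equalityI subsetI)
      fix w assume w: "w \<in> ?B"
      then obtain m where "w = enum S m"
        using enum_surj[OF inf] by blast
      then show "w \<in> enum S ` ?A"
        using w mem by blast
    qed (use mem in blast)
    moreover have "inj_on (enum S) ?A"
      using inf by (auto simp: inj_on_def enum_eq_iff)
    ultimately have "entry_card (colored_enum S) n k = card ?B"
      unfolding entry_card_def by (simp add: card_image)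
    also have "?B = (\<lambda>j. take k z @ [j]) ` {..z ! k}"
    proof (intro equalityI subsetI)
      fix w assume w: "w \<in> ?B"
      have "\<not> w < take (Suc m) z" if "m < k" for m
      proof
        assume "w < take (Suc m) z"
        moreover have "take (Suc m) z \<in> S"
          using take_in_points[of z F a "Suc m"] z by (simp add: S_def)
        ultimately show False
          using w prefix_le that by fastforce
      qed
      then show "w \<in> (\<lambda>j. take k z @ [j]) ` {..z ! k}"
        using le_same_level[of w z k] w k by blast
    next
      fix w assume "w \<in> (\<lambda>j. take k z @ [j]) ` {..z ! k}"
      then obtain j where j: "j \<le> z ! k" and w: "w = take k z @ [j]"
        by blast
      have zk: "z = take k z @ z ! k # drop (Suc k) z"
        using k by (simp add: id_take_nth_drop[symmetric])
      have "take k z @ [j] \<le> take k z @ z ! k # drop (Suc k) z"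
        unfolding append_le_append_iff using j by auto
      then have "w \<le> z"
        using w zk by simp
      \<comment> \<open>Trapped below the next sibling, anything in between properly extends
        \<open>take k z\<close> and so has level at least \<open>k\<close>.\<close>
      have "k < length w'" if w': "w < w'" "w' \<le> z" for w'
      proof -
        have "take k z @ z ! k # drop (Suc k) z < take k z @ [Suc (z ! k)]"
          unfolding append_less_append_iff by simp
        then have "w' < take k z @ [Suc (z ! k)]"
          using that(2) zk by simp
        then obtain c r where "w' = take k z @ c # r"
          using between_siblings[of "take k z" j w' "Suc (z ! k)"] w'(1) w by (metis less_imp_le)
        then show ?thesis
          using k by simp
      qed
      then have "\<not> (\<exists>w'\<in>S. w < w' \<and> w' \<le> z \<and> length w' \<le> k)"
        by (meson not_le)
      moreover have "w \<in> S"
        using sibling_in_points z k unfolding w S_def by blast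
      ultimately show "w \<in> ?B"
        using k \<open>w \<le> z\<close> w by simp
    qed
    also have "card \<dots> = Suc (z ! k)"
      by (subst card_image) (auto simp: inj_on_def)
    finally show ?thesis .
  qed
  moreover have "length z = Suc (snd (colored_enum S) n div 2)"
    using pos[OF z] by (simp add: colored_enum_def z_def[symmetric])
  ultimately show ?thesis
    unfolding reads_def z_def[symmetric] by simp
qed

lemma reads_enum_iff:
  "reads (colored_enum (points F a)) n r \<longleftrightarrow> r = enum (points F a) n"
  using reads_enum reads_unique by blast

text \<open>In the order of \<open>a\<close>, a first entry below \<open>2\<close> forces the node
  \<open>butlast r\<close> to carry the bits of \<open>a\<close>; length \<open>n + 2\<close> makes
  entry \<open>n\<close> part of that node.\<close>

definition decode :: "colored_order \<Rightarrow> baire" where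
  "decode x n = of_bool (\<exists>r. (\<exists>i. reads x i r) \<and> length r = n + 2 \<and> r ! 0 < 2 \<and> r ! n mod 2 = 1)"

text \<open>A first entry below \<open>2\<close> only allows chains of length \<open>0\<close>.\<close>
lemma decode_enum:
  assumes a: "\<And>k. a k \<le> 1"
  shows "decode (colored_enum (points F a)) = a"
proof
  fix n
  let ?S = "points F a"
  have "range (enum ?S) = ?S"
    using bij_enum[OF infinite_points] by (simp add: bij_betw_def)
  then have "(\<exists>i. reads (colored_enum ?S) i r) \<longleftrightarrow> r \<in> ?S" for r
    by (auto simp: reads_enum_iff)
  then have "decode (colored_enum ?S) n =
      of_bool (\<exists>r\<in>?S. length r = n + 2 \<and> r ! 0 < 2 \<and> r ! n mod 2 = 1)"
    by (simp add: decode_def Bex_def)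
  also have "(\<exists>r\<in>?S. length r = n + 2 \<and> r ! 0 < 2 \<and> r ! n mod 2 = 1) \<longleftrightarrow> a n = 1"
  proof
    assume "\<exists>r\<in>?S. length r = n + 2 \<and> r ! 0 < 2 \<and> r ! n mod 2 = 1"
    then obtain r where r: "r \<in> ?S" "length r = n + 2" "r ! 0 < 2" "r ! n mod 2 = 1"
      by blast
    then have "link F (Suc n) (\<lambda>k. butlast r ! k div 2) (\<lambda>k. butlast r ! k mod 2) a"
      by (simp add: points_def nodes_def)
    from link_0_eq[OF this, of n] have "butlast r ! n mod 2 = a n"
      using r by (simp add: nth_butlast)
    then show "a n = 1"
      using r by (simp add: nth_butlast)
  next
    assume n: "a n = 1"
    \<comment> \<open>The bits of \<open>a\<close>, taken as entries, have halves
      \<open>0\<close>.\<close>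
    let ?p = "map a [0..<Suc n]"
    have "k < Suc n \<Longrightarrow> ?p ! k = a k" for k
      by (simp del: upt_Suc)
    moreover have "a k mod 2 = a k" for k
      using a[of k] by simp
    ultimately have "?p \<in> nodes F a"
      using a by (intro nodes_bits) (simp_all add: less_Suc_eq_le del: upt_Suc)
    moreover have "(?p @ [0]) ! 0 < 2" "(?p @ [0]) ! n mod 2 = 1"
      using a[of 0] n by (auto simp del: upt_Suc simp: nth_append)
    ultimately show "\<exists>r\<in>?S. length r = n + 2 \<and> r ! 0 < 2 \<and> r ! n mod 2 = 1"
      by (intro bexI[of _ "?p @ [0]"]) (auto simp del: upt_Suc)
  qed
  finally show "decode (colored_enum ?S) n = a n"
    using a[of n] by (auto simp: le_Suc_eq)
qed

text \<open>Stands for isomorphism with \<open>colored_enum S\<close>, but quantifies only over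
  numbers and finite sequences and so stays Borel.\<close>

definition enumerates :: "colored_order \<Rightarrow> nat list set \<Rightarrow> bool" where
  "enumerates x S \<longleftrightarrow>
     (\<forall>n. \<exists>r\<in>S. reads x n r) \<and> (\<forall>r\<in>S. \<exists>n. reads x n r) \<and>
     (\<forall>m n r s. reads x m r \<and> reads x n s \<longrightarrow> (fst x (m, n) \<longleftrightarrow> r < s)) \<and>
     (\<forall>n r. reads x n r \<longrightarrow> snd x n = colour r)"

lemma colored_iso_iff:
  "(x, y) \<in> colored_iso \<longleftrightarrow> fst x \<in> LO \<and> fst y \<in> LO \<and>
     (\<exists>g. bij g \<and> (\<forall>m n. fst x (m, n) \<longleftrightarrow> fst y (g m, g n)) \<and> (\<forall>n. snd x n = snd y (g n)))"
  by (auto simp: colored_iso_def order_embedding_def bij_def case_prod_beta)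

lemma decode_iso:
  assumes "(x, y) \<in> colored_iso"
  shows "decode x = decode y"
proof -
  obtain g where g: "bij g" "\<And>m n. fst x (m, n) \<longleftrightarrow> fst y (g m, g n)" "\<And>n. snd x n = snd y (g n)"
    using assms unfolding colored_iso_iff by blast
  have "(\<exists>i. reads x i r) \<longleftrightarrow> (\<exists>i. reads y i r)" for r
  proof
    assume "\<exists>i. reads y i r"
    then obtain i where "reads y i r" ..
    moreover obtain j where "i = g j"
      using surjD[OF bij_is_surj[OF g(1)]] by blast
    ultimately show "\<exists>i. reads x i r"
      using reads_iso[OF g] by blast
  qed (use reads_iso[OF g] in blast)
  then show ?thesis
    by (simp add: decode_def fun_eq_iff)
qed

text \<open>By rigidity there is only one candidate for the isomorphism: \<open>g\<close> sends an
  element to the index of the sequence that it reads.\<close>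

lemma enumerates_iff:
  fixes F a
  defines "S \<equiv> points F a"
  assumes x: "fst x \<in> LO"
  shows "enumerates x S \<longleftrightarrow> (x, colored_enum S) \<in> colored_iso"
proof
  have inf: "infinite S"
    by (simp add: S_def infinite_points)
  assume en: "enumerates x S"
  have "\<exists>m. reads x n (enum S m)" for n
  proof -
    obtain r where "r \<in> S" "reads x n r"
      using en unfolding enumerates_def by blast
    moreover from this(1) obtain m where "r = enum S m"
      using enum_surj[OF inf] by blast
    ultimately show ?thesis
      by blast
  qed
  then obtain g where g: "\<And>n. reads x n (enum S (g n))"
    by metis
  have ord: "fst x (m, n) \<longleftrightarrow> enum S (g m) < enum S (g n)" for m n
    using en g unfolding enumerates_def by blast
  have col: "snd x n = colour (enum S (g n))" for n
    using en g unfolding enumerates_def by blast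
  \<comment> \<open>Distinct elements are comparable in \<open>x\<close>, so a common reading would
    lie strictly below itself.\<close>
  have "inj g"
  proof (rule injI, rule ccontr)
    fix m n assume "g m = g n" "m \<noteq> n"
    then have "fst x (m, n) \<or> fst x (n, m)"
      using x by (auto simp: LO_def strict_linear_order_on_def total_on_def)
    then show False
      using ord \<open>g m = g n\<close> by auto
  qed
  moreover have "\<exists>n. g n = m" for m
  proof -
    obtain n where "reads x n (enum S m)"
      using en enum_in[OF inf] unfolding enumerates_def by blast
    then have "enum S m = enum S (g n)"
      using g reads_unique by blast
    then show ?thesis
      using enum_eq_iff[OF inf] by auto
  qed
  ultimately have "bij g"
    unfolding bij_def surj_def by metis
  then show "(x, colored_enum S) \<in> colored_iso"
    unfolding colored_iso_iff using x colored_enum_LO[OF inf] ord col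
    by (auto simp: colored_enum_def intro!: exI[of _ g])
next
  have inf: "infinite S"
    by (simp add: S_def infinite_points)
  assume "(x, colored_enum S) \<in> colored_iso"
  then obtain g where g: "bij g" "\<And>m n. fst x (m, n) \<longleftrightarrow> fst (colored_enum S) (g m, g n)"
    "\<And>n. snd x n = snd (colored_enum S) (g n)"
    unfolding colored_iso_iff by blast
  have "reads x n r \<longleftrightarrow> r = enum S (g n)" for n r
    using reads_iso[OF g, of n r] by (simp add: S_def reads_enum_iff)
  moreover have "\<exists>n. r = enum S (g n)" if r: "r \<in> S" for r
  proof -
    obtain m where "r = enum S m"
      using enum_surj[OF inf r] .
    moreover obtain n where "m = g n"
      using surjD[OF bij_is_surj[OF g(1)]] by blast
    ultimately show ?thesis
      by blast
  qed
  ultimately show "enumerates x S"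
    unfolding enumerates_def using enum_in[OF inf] g(2,3) by (auto simp: colored_enum_def)
qed

section \<open>Borel complexity and universality\<close>

text \<open>Second countability is what lets \<open>borel_prod\<close> split the Borel structure of
  the space of coloured orders.\<close>

instance bool :: second_countable_topology
proof
  have "generate_topology (UNIV :: bool set set) A" for A
    by (rule generate_topology.Basis) simp
  then show "\<exists>B :: bool set set. countable B \<and> open = generate_topology B"
    by (intro exI[of _ UNIV]) (simp add: fun_eq_iff open_discrete)
qed

lemma second_countable_euclidean: "second_countable (euclidean :: 'a::second_countable_topology topology)"
proof -
  obtain B :: "'a set set" where B: "countable B" "topological_basis B"
    using ex_countable_basis by blast
  show ?thesis
    unfolding second_countable_def
  proof (intro exI[of _ B] conjI ballI allI impI)
    show "openin euclidean V" if "V \<in> B" for V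
      using topological_basis_open[OF B(2) that] by simp
    fix U :: "'a set" and x assume "openin euclidean U \<and> x \<in> U"
    then have "open U" "x \<in> U"
      by simp_all
    then obtain V where "V \<in> B" "x \<in> V" "V \<subseteq> U"
      by (rule topological_basisE[OF B(2)])
    then show "\<exists>V\<in>B. x \<in> V \<and> V \<subseteq> U"
      by blast
  qed (rule B(1))
qed

lemma closed_LO: "closed LO"
proof -
  have entry: "closed {L :: nat \<times> nat \<Rightarrow> bool. L p = t}" for p t
  proof -
    have "closed ((\<lambda>L :: nat \<times> nat \<Rightarrow> bool. L p) -` {t})"
      by (rule closed_vimage) simp_all
    then show ?thesis
      by (simp add: vimage_def)
  qed
  have "LO = {L. (\<forall>x y z. L (x, y) = False \<or> L (y, z) = False \<or> L (x, z) = True) \<and>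
      (\<forall>x. L (x, x) = False) \<and> (\<forall>x y. x = y \<or> L (x, y) = True \<or> L (y, x) = True)}"
    unfolding LO_def strict_linear_order_on_def trans_def irrefl_def total_on_def
    by (intro Collect_cong; simp; intro conj_cong; blast)
  also have "closed \<dots>"
    by (intro closed_Collect_conj closed_Collect_all closed_Collect_disj entry closed_Collect_const)
  finally show ?thesis .
qed

lemma space_colored_LO [simp]: "space colored_LO = LO \<times> UNIV"
  by (simp add: colored_LO_def space_restrict_space)

lemma standard_borel_colored_LO: "standard_borel colored_LO"
  unfolding standard_borel_def
proof (intro exI conjI)
  let ?X = "LO \<times> UNIV :: colored_order set"
  have closed: "closed ?X"
    by (intro closed_Times closed_LO closed_UNIV)
  have "completely_metrizable_space (euclidean :: colored_order topology)"
    by (intro completely_metrizable_space_prod completely_metrizable_space_fun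
        completely_metrizable_space_discrete)
  then show "completely_metrizable_space (top_of_set ?X)"
    using closed by (intro completely_metrizable_space_closedin) simp_all
  show "second_countable (top_of_set ?X)"
    by (intro second_countable_subtopology second_countable_euclidean)
  show "topspace (top_of_set ?X) = space colored_LO"
    by simp
  have "sets colored_LO = (\<inter>) ?X ` sigma_sets UNIV {U. open U}"
    by (simp add: colored_LO_def sets_restrict_space sets_borel)
  also have "\<dots> = sigma_sets ?X ((\<inter>) ?X ` {U. open U})"
    using closed by (intro sigma_sets_Int) (simp_all flip: sets_borel)
  also have "(\<inter>) ?X ` {U. open U} = {U. openin (top_of_set ?X) U}"
    by (auto simp: openin_open)
  finally show "sets colored_LO = sigma_sets (space colored_LO) {U. openin (top_of_set ?X) U}"
    by simp
qed

lemma measurable_fst_entry [measurable]: "Measurable.pred colored_LO (\<lambda>x. fst x p)"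
proof -
  have "(\<lambda>x :: colored_order. fst x p) \<in> borel \<rightarrow>\<^sub>M borel"
    by (rule measurable_compose[OF _ measurable_product_coordinates]) (simp add: borel_prod[symmetric])
  then have "(\<lambda>x :: colored_order. fst x p) \<in> borel \<rightarrow>\<^sub>M count_space UNIV"
    by (simp add: measurable_cong_sets[OF refl sets_borel_eq_count_space])
  then show ?thesis
    unfolding colored_LO_def by (rule measurable_restrict_space1)
qed

lemma measurable_snd_entry [measurable]: "(\<lambda>x. snd x n) \<in> colored_LO \<rightarrow>\<^sub>M count_space UNIV"
proof -
  have "(\<lambda>x :: colored_order. snd x n) \<in> borel \<rightarrow>\<^sub>M count_space UNIV"
    by (rule measurable_compose[OF _ measurable_entry]) (simp add: borel_prod[symmetric])
  then show ?thesis
    unfolding colored_LO_def by (rule measurable_restrict_space1)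
qed

section \<open>Coloured embeddability and isomorphism as analytic relations\<close>

lemma colored_emb_iff:
  "(x, y) \<in> colored_emb R \<longleftrightarrow> fst x \<in> LO \<and> fst y \<in> LO \<and>
     (\<exists>g. inj g \<and> (\<forall>m n. fst x (m, n) \<longleftrightarrow> fst y (g m, g n)) \<and> (\<forall>n. (snd x n, snd y (g n)) \<in> R))"
  by (cases x; cases y) (simp add: colored_emb_def order_embedding_def conj_assoc)

lemma inj_iff_no_collision: "inj g \<longleftrightarrow> (\<forall>m n. m \<noteq> n \<longrightarrow> \<not> (\<exists>i. g m = i \<and> g n = i))"
  unfolding inj_def by metis

lemma analytic_setI:
  assumes "B \<in> sets (X \<Otimes>\<^sub>M (borel :: baire measure))" "\<And>x. x \<in> A \<longleftrightarrow> (\<exists>g. (x, g) \<in> B)"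
  shows "analytic_set X A"
proof -
  have "A = fst ` B"
    using assms(2) by force
  then show ?thesis
    unfolding analytic_set_def using assms(1) by blast
qed

text \<open>Below, \<open>g m = i\<close> under a quantifier over \<open>i\<close> reduces measurability to that of evaluation at constants.\<close>

lemma analytic_colored_emb: "analytic_set (colored_LO \<Otimes>\<^sub>M colored_LO) (colored_emb R)"
proof -
  let ?M = "(colored_LO \<Otimes>\<^sub>M colored_LO) \<Otimes>\<^sub>M (borel :: baire measure)"
  let ?B = "{p \<in> space ?M. (\<forall>m n. m \<noteq> n \<longrightarrow> \<not> (\<exists>i. snd p m = i \<and> snd p n = i)) \<and>
    (\<forall>m n. fst (fst (fst p)) (m, n) \<longleftrightarrow>
       (\<exists>i j. snd p m = i \<and> snd p n = j \<and> fst (snd (fst p)) (i, j))) \<and>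
    (\<forall>n. \<exists>i j k. snd (fst (fst p)) n = i \<and> snd p n = j \<and> snd (snd (fst p)) j = k \<and> (i, k) \<in> R)}"
  show ?thesis
  proof (rule analytic_setI)
    show "?B \<in> sets ?M"
      by measurable
    show "z \<in> colored_emb R \<longleftrightarrow> (\<exists>g. (z, g) \<in> ?B)" for z
    proof -
      obtain x y where z: "z = (x, y)"
        by (rule prod.exhaust)
      show ?thesis
        unfolding z colored_emb_iff inj_iff_no_collision
        by (simp add: space_pair_measure mem_Times_iff)
    qed
  qed
qed

lemma analytic_colored_iso: "analytic_set (colored_LO \<Otimes>\<^sub>M colored_LO) colored_iso"
proof -
  let ?M = "(colored_LO \<Otimes>\<^sub>M colored_LO) \<Otimes>\<^sub>M (borel :: baire measure)"
  let ?B = "{p \<in> space ?M. ((\<forall>m n. m \<noteq> n \<longrightarrow> \<not> (\<exists>i. snd p m = i \<and> snd p n = i)) \<and> (\<forall>m. \<exists>n. snd p n = m)) \<and>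
    (\<forall>m n. fst (fst (fst p)) (m, n) \<longleftrightarrow>
       (\<exists>i j. snd p m = i \<and> snd p n = j \<and> fst (snd (fst p)) (i, j))) \<and>
    (\<forall>n. \<exists>j k. snd p n = j \<and> snd (fst (fst p)) n = k \<and> snd (snd (fst p)) j = k)}"
  have bij_iff: "bij g \<longleftrightarrow> inj g \<and> (\<forall>m. \<exists>n. g n = m)" for g :: baire
    unfolding bij_def surj_def by metis
  show ?thesis
  proof (rule analytic_setI)
    show "?B \<in> sets ?M"
      by measurable
    show "z \<in> colored_iso \<longleftrightarrow> (\<exists>g. (z, g) \<in> ?B)" for z
    proof -
      obtain x y where z: "z = (x, y)"
        by (rule prod.exhaust)
      show ?thesis
        unfolding z colored_iso_iff bij_iff inj_iff_no_collision
        by (simp add: space_pair_measure mem_Times_iff eq_commute)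
    qed
  qed
qed

lemma colored_emb_refl:
  assumes "refl R" "fst x \<in> LO"
  shows "(x, x) \<in> colored_emb R"
  unfolding colored_emb_iff using assms by (auto intro!: exI[of _ id] simp: refl_on_def)

lemma colored_emb_trans:
  assumes "trans R" "(x, y) \<in> colored_emb R" "(y, z) \<in> colored_emb R"
  shows "(x, z) \<in> colored_emb R"
proof -
  obtain g where g: "inj g" "\<And>m n. fst x (m, n) \<longleftrightarrow> fst y (g m, g n)" "\<And>n. (snd x n, snd y (g n)) \<in> R"
      "fst x \<in> LO"
    using assms(2) unfolding colored_emb_iff by blast
  obtain h where h: "inj h" "\<And>m n. fst y (m, n) \<longleftrightarrow> fst z (h m, h n)" "\<And>n. (snd y n, snd z (h n)) \<in> R"
      "fst z \<in> LO"
    using assms(3) unfolding colored_emb_iff by blast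
  have "(snd x n, snd z (h (g n))) \<in> R" for n
    using transD[OF assms(1) g(3) h(3)] .
  then show ?thesis
    unfolding colored_emb_iff using g(1,2,4) h(1,2,4)
    by (intro conjI exI[of _ "h \<circ> g"]) (simp_all add: inj_compose)
qed

lemma analytic_quasi_order_colored_emb:
  assumes "preorder_on UNIV R"
  shows "analytic_quasi_order colored_LO (colored_emb R)"
  unfolding analytic_quasi_order_def preorder_on_def
proof (intro conjI analytic_colored_emb)
  show "colored_emb R \<subseteq> space colored_LO \<times> space colored_LO"
    by (auto simp: colored_emb_def)
  show "refl_on (space colored_LO) (colored_emb R)"
    using assms by (intro refl_onI colored_emb_refl) (auto simp: preorder_on_def dest: refl_onD)
  show "trans (colored_emb R)"
    using assms by (auto simp: preorder_on_def intro!: transI elim: colored_emb_trans)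
qed

lemma colored_iso_refl: "fst x \<in> LO \<Longrightarrow> (x, x) \<in> colored_iso"
  unfolding colored_iso_iff by (auto intro!: exI[of _ id])

lemma colored_iso_sym:
  assumes "(x, y) \<in> colored_iso"
  shows "(y, x) \<in> colored_iso"
proof -
  obtain g where g: "bij g" "\<And>m n. fst x (m, n) \<longleftrightarrow> fst y (g m, g n)" "\<And>n. snd x n = snd y (g n)"
      and LO: "fst x \<in> LO" "fst y \<in> LO"
    using assms unfolding colored_iso_iff by blast
  have "g (inv g n) = n" for n
    using g(1) by (simp add: bij_is_surj surj_f_inv_f)
  then show ?thesis
    unfolding colored_iso_iff using LO g(2,3) bij_imp_bij_inv[OF g(1)] by (auto intro!: exI[of _ "inv g"])
qed

lemma colored_iso_trans:
  assumes "(x, y) \<in> colored_iso" "(y, z) \<in> colored_iso"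
  shows "(x, z) \<in> colored_iso"
proof -
  obtain g where g: "bij g" "\<And>m n. fst x (m, n) \<longleftrightarrow> fst y (g m, g n)" "\<And>n. snd x n = snd y (g n)"
      "fst x \<in> LO"
    using assms(1) unfolding colored_iso_iff by blast
  obtain h where h: "bij h" "\<And>m n. fst y (m, n) \<longleftrightarrow> fst z (h m, h n)" "\<And>n. snd y n = snd z (h n)"
      "fst z \<in> LO"
    using assms(2) unfolding colored_iso_iff by blast
  show ?thesis
    unfolding colored_iso_iff using g h bij_comp[OF g(1) h(1)] by (auto intro!: exI[of _ "h \<circ> g"])
qed

lemma analytic_equivalence_colored_iso: "analytic_equivalence colored_LO colored_iso"
  unfolding analytic_equivalence_def
proof (intro conjI analytic_colored_iso)
  show "equiv (space colored_LO) colored_iso"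
  proof (intro equivI)
    show "colored_iso \<subseteq> space colored_LO \<times> space colored_LO"
      by (auto simp: colored_iso_def)
    show "refl_on (space colored_LO) colored_iso"
      by (auto simp: refl_on_def intro: colored_iso_refl)
  qed (auto intro!: symI transI intro: colored_iso_sym elim: colored_iso_trans)
qed

lemma colored_iso_imp_emb: "colored_iso \<subseteq> colored_emb Id"
  by (auto simp: colored_iso_def colored_emb_def)

section \<open>Measurability of the construction and of its decoding\<close>

lemma measurable_entry_card [measurable]:
  "(\<lambda>x. entry_card x n k) \<in> colored_LO \<rightarrow>\<^sub>M count_space UNIV"
  unfolding entry_card_def by measurable

lemma measurable_reads [measurable]: "Measurable.pred colored_LO (\<lambda>x. reads x n r)"
  unfolding reads_def by measurable

lemma measurable_decode [measurable]: "decode \<in> colored_LO \<rightarrow>\<^sub>M borel"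
proof (rule measurable_coordinatewise_then_product)
  show "(\<lambda>x. decode x n) \<in> colored_LO \<rightarrow>\<^sub>M borel" for n
    unfolding decode_def by measurable
qed

text \<open>Only the first \<open>length p\<close> entries of \<open>a\<close> matter, so the set is
  a countable union of cylinders, whatever \<open>F\<close> is.\<close>

lemma measurable_nodes [measurable]: "Measurable.pred borel (\<lambda>a. p \<in> nodes F a)"
proof -
  have eq: "(\<lambda>a. p \<in> nodes F a) =
      (\<lambda>a. \<exists>l. p \<in> nodes F (\<lambda>k. l ! k) \<and> (\<forall>k. k < length p \<longrightarrow> a k = l ! k))"
  proof (rule ext, rule iffI)
    fix a
    assume "p \<in> nodes F a"
    then have "link F (length p) (\<lambda>k. p ! k div 2) (\<lambda>k. p ! k mod 2) a"
      by (simp add: nodes_def)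
    then have "link F (length p) (\<lambda>k. p ! k div 2) (\<lambda>k. p ! k mod 2) (\<lambda>k. map a [0..<length p] ! k)"
      by (rule link_cong) simp
    then show "\<exists>l. p \<in> nodes F (\<lambda>k. l ! k) \<and> (\<forall>k. k < length p \<longrightarrow> a k = l ! k)"
      by (intro exI[of _ "map a [0..<length p]"]) (simp add: nodes_def)
  next
    fix a
    assume "\<exists>l. p \<in> nodes F (\<lambda>k. l ! k) \<and> (\<forall>k. k < length p \<longrightarrow> a k = l ! k)"
    then obtain l where L: "link F (length p) (\<lambda>k. p ! k div 2) (\<lambda>k. p ! k mod 2) (\<lambda>k. l ! k)"
      and l: "\<And>k. k < length p \<Longrightarrow> a k = l ! k"
      by (auto simp: nodes_def)
    from L have "link F (length p) (\<lambda>k. p ! k div 2) (\<lambda>k. p ! k mod 2) a"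
      by (rule link_cong) (simp add: l)
    then show "p \<in> nodes F a"
      by (simp add: nodes_def)
  qed
  show ?thesis
    by (subst eq) measurable
qed

lemma measurable_points [measurable]: "Measurable.pred borel (\<lambda>a. r \<in> points F a)"
  unfolding points_def by simp

text \<open>Counting smaller elements turns the recursive \<open>enumerate\<close> into membership
  and a cardinality, both of which are measurable for the point sets.\<close>

lemma enumerate_eq_iff:
  fixes A :: "nat set"
  assumes "infinite A"
  shows "enumerate A n = m \<longleftrightarrow> m \<in> A \<and> card {k \<in> A. k < m} = n"
proof -
  have card: "card {k \<in> A. k < enumerate A i} = i" for i
  proof -
    have "{k \<in> A. k < enumerate A i} = enumerate A ` {..<i}"
      using assms by (auto simp: enumerate_in_set enumerate_mono dest!: enumerate_Ex[OF assms])
    then show ?thesis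
      using assms by (simp add: card_image inj_enumerate inj_on_subset[OF inj_enumerate])
  qed
  show ?thesis
    using card enumerate_Ex[OF assms] enumerate_in_set[OF assms] by metis
qed

lemma measurable_enum [measurable]: "(\<lambda>a. enum (points F a) n) \<in> borel \<rightarrow>\<^sub>M count_space UNIV"
proof -
  have inf: "infinite (to_nat ` points F a)" for a
    using infinite_points finite_imageD[OF _ inj_on_subset[OF inj_to_nat subset_UNIV]] by blast
  have mem: "k \<in> to_nat ` points F a \<longleftrightarrow> (\<exists>r. r \<in> points F a \<and> to_nat r = k)" for k a
    by auto
  have "(\<lambda>a. enumerate (to_nat ` points F a) n) \<in> borel \<rightarrow>\<^sub>M count_space UNIV"
    unfolding measurable_count_space_eq2_countable
  proof (intro conjI ballI)
    fix m :: nat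
    have "(\<lambda>a. enumerate (to_nat ` points F a) n) -` {m} \<inter> space borel =
        {a \<in> space borel. (\<exists>r. r \<in> points F a \<and> to_nat r = m) \<and>
           card {k. (\<exists>r. r \<in> points F a \<and> to_nat r = k) \<and> k < m} = n}"
      unfolding vimage_def singleton_iff enumerate_eq_iff[OF inf] mem by auto
    also have "\<dots> \<in> sets borel"
      by measurable
    finally show "(\<lambda>a. enumerate (to_nat ` points F a) n) -` {m} \<inter> space borel \<in> sets borel" .
  qed simp_all
  then show ?thesis
    unfolding enum_def by (rule measurable_compose) simp
qed

lemma measurable_colored_enum: "(\<lambda>a. colored_enum (points F a)) \<in> borel \<rightarrow>\<^sub>M colored_LO"
proof -
  have "(\<lambda>a. \<lambda>p. enum (points F a) (fst p) < enum (points F a) (snd p)) \<in> borel \<rightarrow>\<^sub>M borel"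
  proof (rule measurable_coordinatewise_then_product)
    fix p :: "nat \<times> nat"
    have "(\<lambda>a. enum (points F a) (fst p) < enum (points F a) (snd p)) =
        (\<lambda>a. \<exists>r s. enum (points F a) (fst p) = r \<and> enum (points F a) (snd p) = s \<and> r < s)"
      by simp
    also have "\<dots> \<in> borel \<rightarrow>\<^sub>M count_space UNIV"
      by measurable
    finally show "(\<lambda>a. enum (points F a) (fst p) < enum (points F a) (snd p)) \<in> borel \<rightarrow>\<^sub>M borel"
      by (simp add: measurable_cong_sets[OF refl sets_borel_eq_count_space])
  qed
  moreover have "(\<lambda>a n. colour (enum (points F a) n)) \<in> borel \<rightarrow>\<^sub>M borel"
    by (rule measurable_coordinatewise_then_product) (rule measurable_compose[OF measurable_enum], simp)
  ultimately have "(\<lambda>a. colored_enum (points F a)) \<in> borel \<rightarrow>\<^sub>M borel"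
    unfolding colored_enum_def case_prod_beta' by (simp add: borel_prod[symmetric])
  then show ?thesis
    unfolding colored_LO_def
    by (rule measurable_restrict_space2[rotated]) (auto simp: colored_enum_LO infinite_points mem_Times_iff)
qed

text \<open>\<open>h\<close> sends a point to the coloured order of its code and reduces
  \<open>R\<close> to \<open>S\<close>. As the code can be recovered, the isomorphism closure
  \<open>B\<close> of the image is Borel, and \<open>g\<close> leads from \<open>B\<close> back to
  \<open>Y\<close>.\<close>

lemma bireducible_invariant_set:
  assumes S: "trans S" "colored_emb Id \<subseteq> S" "S \<subseteq> colored_emb geq_rel"
    and Y: "standard_borel Y" and qo: "preorder_on (space Y) R" "analytic_set (Y \<Otimes>\<^sub>M Y) R"
  shows "\<exists>B\<in>sets colored_LO. colored_iso `` B \<subseteq> B \<and>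
    borel_bireducible Y R (restrict_space colored_LO B) (Restr S B)"
proof -
  obtain e :: "_ \<Rightarrow> baire" where e: "e \<in> Y \<rightarrow>\<^sub>M borel" and img: "e ` space Y \<in> sets borel" and "\<forall>x k. e x k \<le> 1"
    and "\<forall>x\<in>space Y. \<forall>y\<in>space Y. (\<forall>k. e x k \<le> e y k) \<longrightarrow> x = y"
    and inv: "the_inv_into (space Y) e \<in> restrict_space borel (e ` space Y) \<rightarrow>\<^sub>M Y"
    by (rule standard_borel_coding[OF Y])
  then have e1: "e x k \<le> 1" and e_le: "x \<in> space Y \<Longrightarrow> y \<in> space Y \<Longrightarrow> (\<And>k. e x k \<le> e y k) \<Longrightarrow> x = y"
    for x y k
    by simp_all
  have iso_S: "colored_iso \<subseteq> S"
    using colored_iso_imp_emb S(2) by blast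
  have inj: "inj_on e (space Y)"
    by (rule inj_onI) (rule e_le, auto)
  have R: "R \<subseteq> space Y \<times> space Y" "\<And>x. x \<in> space Y \<Longrightarrow> (x, x) \<in> R" "trans R"
    using qo(1) by (auto simp: preorder_on_def dest: refl_onD)
  obtain F :: "(baire \<times> baire \<times> baire) set" where F: "closed F"
    and F_R: "\<forall>a b. (\<exists>w. (a, b, w) \<in> F) \<longleftrightarrow> (\<exists>x y. (x, y) \<in> R \<and> a = e x \<and> b = e y)"
    by (rule analytic_set_closed_projection[OF img inj inv qo(2)])
  define h where "h y = colored_enum (points F (e y))" for y
  have h: "h \<in> Y \<rightarrow>\<^sub>M colored_LO"
    unfolding h_def by (rule measurable_compose[OF e measurable_colored_enum])
  have h_LO: "fst (h y) \<in> LO" for y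
    by (simp add: h_def colored_enum_LO infinite_points)
  have F_trans: "\<exists>w. (a, c, w) \<in> F" if abc: "(a, b, w) \<in> F" "(b, c, w') \<in> F" for a b c w w'
  proof -
    obtain x y where xy: "(x, y) \<in> R" "a = e x" "b = e y"
      using F_R abc(1) by blast
    obtain y' z where yz: "(y', z) \<in> R" "b = e y'" "c = e z"
      using F_R abc(2) by blast
    have "y = y'"
      using inj_onD[OF inj, of y y'] xy yz R(1) by auto
    then show ?thesis
      using F_R xy yz transD[OF R(3)] by blast
  qed
  have h_R: "(x, y) \<in> R \<longleftrightarrow> (h x, h y) \<in> S" if xy: "x \<in> space Y" "y \<in> space Y" for x y
  proof
    assume "(x, y) \<in> R"
    then obtain w where w: "(e x, e y, w) \<in> F"
      using F_R by blast
    \<comment> \<open>Shifting by the certificate preserves colours exactly, so it embeds even for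
      equality, the smallest relation allowed for \<open>S\<close>.\<close>
    let ?G = "shift (\<lambda>k. Suc (w k))"
    have "(h x, h y) \<in> colored_emb Id"
      unfolding h_def colored_emb_enum_iff[OF infinite_points infinite_points]
      by (intro exI[of _ ?G] conjI ballI impI)
        (simp_all add: shift_in_points[OF w e1 e1] colour_shift shift_less)
    then show "(h x, h y) \<in> S"
      using S(2) by blast
  next
    assume "(h x, h y) \<in> S"
    then have "(h x, h y) \<in> colored_emb geq_rel"
      using S(3) by blast
    then obtain G where G: "\<And>r. r \<in> points F (e x) \<Longrightarrow> G r \<in> points F (e y)"
      "\<And>r. r \<in> points F (e x) \<Longrightarrow> colour (G r) \<le> colour r"
      "\<And>r r'. r \<in> points F (e x) \<Longrightarrow> r' \<in> points F (e x) \<Longrightarrow> r < r' \<Longrightarrow> G r < G r'"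
      unfolding h_def colored_emb_enum_iff[OF infinite_points infinite_points] by auto
    show "(x, y) \<in> R"
    proof (rule branch_of_embedding[of "e x" F G "e y"])
      \<comment> \<open>\<open>v\<close> lies pointwise below \<open>e x\<close>; as soon as it is
        known to be a code, incomparability of codes gives \<open>v = e x\<close>.\<close>
      fix s v assume v: "\<And>k. v k \<le> e x k" and link: "\<And>n. link F n s v (e y)"
      have "v = e y \<or> (\<exists>w. (v, e y, w) \<in> F)"
        by (rule link_limit[OF F link]) (rule F_trans)
      then show "(x, y) \<in> R"
      proof
        assume "v = e y"
        then have "y = x"
          using e_le[OF xy(2,1)] v by simp
        then show ?thesis
          using R(2) xy by simp
      next
        assume "\<exists>w. (v, e y, w) \<in> F"
        then obtain x' y' where x': "(x', y') \<in> R" "v = e x'" "e y = e y'"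
          using F_R by blast
        then have "x' \<in> space Y" "y' \<in> space Y"
          using R(1) by auto
        then have "x' = x" "y' = y"
          using e_le[of x' x] v x'(2,3) xy inj_onD[OF inj, of y y'] by auto
        then show ?thesis
          using x'(1) by simp
      qed
    qed (use e1 G in simp_all)
  qed
  \<comment> \<open>The isomorphism closure of the image of \<open>h\<close>, in Borel form: the
    only possible code is computed first, and then the order is compared with the one built from
    it.\<close>
  define B where "B = {x \<in> space colored_LO. decode x \<in> e ` space Y \<and> enumerates x (points F (decode x))}"
  have B: "B \<in> sets colored_LO"
  proof -
    have [measurable]: "Measurable.pred borel (\<lambda>a. a \<in> e ` space Y)"
      using img by simp
    show ?thesis
      unfolding B_def enumerates_def Bex_def Ball_def by measurable
  qed
  have B_iff: "x \<in> B \<longleftrightarrow> (\<exists>y\<in>space Y. e y = decode x \<and> (x, h y) \<in> colored_iso)" for x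
  proof
    assume "x \<in> B"
    then show "\<exists>y\<in>space Y. e y = decode x \<and> (x, h y) \<in> colored_iso"
      using enumerates_iff[of x F "decode x"] unfolding B_def h_def by auto
  next
    assume "\<exists>y\<in>space Y. e y = decode x \<and> (x, h y) \<in> colored_iso"
    then obtain y where y: "y \<in> space Y" "e y = decode x" "(x, h y) \<in> colored_iso"
      by blast
    then have "fst x \<in> LO"
      by (simp add: colored_iso_iff)
    moreover from y(1,2) have "decode x \<in> e ` space Y"
      by (metis imageI)
    ultimately show "x \<in> B"
      using enumerates_iff[of x F "decode x"] y(2,3) unfolding B_def h_def by (simp add: mem_Times_iff)
  qed
  have decode_h: "decode (h y) = e y" for y
    unfolding h_def by (rule decode_enum[OF e1])
  have h_B: "h y \<in> B" if "y \<in> space Y" for y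
    using that colored_iso_refl[OF h_LO] by (auto simp: B_iff decode_h)
  define g where "g x = the_inv_into (space Y) e (decode x)" for x
  have g: "g \<in> restrict_space colored_LO B \<rightarrow>\<^sub>M Y"
    unfolding g_def
    by (rule measurable_compose[OF measurable_restrict_space3[OF measurable_decode] inv]) (auto simp: B_def)
  have g_B: "g x \<in> space Y" "(x, h (g x)) \<in> colored_iso" if x: "x \<in> B" for x
  proof -
    obtain y where y: "y \<in> space Y" "e y = decode x" "(x, h y) \<in> colored_iso"
      using x B_iff by blast
    then have "g x = y"
      unfolding g_def using the_inv_into_f_f[OF inj y(1)] by simp
    then show "g x \<in> space Y" "(x, h (g x)) \<in> colored_iso"
      using y by simp_all
  qed
  \<comment> \<open>Each \<open>x\<close> in \<open>B\<close> is isomorphic to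
    \<open>h (g x)\<close>, hence related to it by \<open>S\<close> in both directions, so the claim
    reduces to \<open>h_R\<close>.\<close>
  have g_S: "(x, y) \<in> S \<longleftrightarrow> (g x, g y) \<in> R" if "x \<in> B" "y \<in> B" for x y
  proof -
    have "(x, h (g x)) \<in> S" "(h (g x), x) \<in> S" "(y, h (g y)) \<in> S" "(h (g y), y) \<in> S"
      using g_B(2)[OF that(1)] g_B(2)[OF that(2)] colored_iso_sym iso_S by blast+
    then have "(x, y) \<in> S \<longleftrightarrow> (h (g x), h (g y)) \<in> S"
      using transD[OF S(1)] by blast
    then show ?thesis
      using h_R g_B(1) that by simp
  qed
  have space_B: "space (restrict_space colored_LO B) = B"
    using sets.sets_into_space[OF B] by (auto simp: space_restrict_space)
  show "\<exists>B\<in>sets colored_LO. colored_iso `` B \<subseteq> B \<and>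
      borel_bireducible Y R (restrict_space colored_LO B) (Restr S B)"
  proof (intro bexI[OF _ B] conjI)
    show "colored_iso `` B \<subseteq> B"
    proof
      fix y assume "y \<in> colored_iso `` B"
      then obtain x where x: "x \<in> B" "(x, y) \<in> colored_iso"
        by blast
      then obtain z where z: "z \<in> space Y" "e z = decode x" "(x, h z) \<in> colored_iso"
        using B_iff by blast
      have "(y, h z) \<in> colored_iso"
        using colored_iso_trans[OF colored_iso_sym[OF x(2)] z(3)] .
      then show "y \<in> B"
        using z decode_iso[OF x(2)] B_iff by auto
    qed
    show "borel_bireducible Y R (restrict_space colored_LO B) (Restr S B)"
      unfolding borel_bireducible_def borel_reducible_def space_B
    proof (intro conjI)
      show "\<exists>h\<in>Y \<rightarrow>\<^sub>M restrict_space colored_LO B.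
          \<forall>x\<in>space Y. \<forall>y\<in>space Y. (x, y) \<in> R \<longleftrightarrow> (h x, h y) \<in> Restr S B"
        using h h_R h_B by (intro bexI[of _ h] measurable_restrict_space2) auto
      show "\<exists>g\<in>restrict_space colored_LO B \<rightarrow>\<^sub>M Y. \<forall>x\<in>B. \<forall>y\<in>B. (x, y) \<in> Restr S B \<longleftrightarrow> (g x, g y) \<in> R"
        using g g_S by (intro bexI[of _ g]) auto
    qed
  qed
qed

lemma invariantly_universal_between:
  assumes S: "analytic_quasi_order colored_LO S" "colored_emb Id \<subseteq> S" "S \<subseteq> colored_emb geq_rel"
  shows "invariantly_universal TYPE('b) colored_LO S colored_iso"
proof -
  have "colored_iso \<subseteq> S"
    using colored_iso_imp_emb S(2) by (rule subset_trans)
  then have "colored_iso \<subseteq> S \<inter> S\<inverse>"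
    by (auto dest: colored_iso_sym)
  moreover have "trans S"
    using S(1) by (simp add: analytic_quasi_order_def preorder_on_def)
  ultimately show ?thesis
    unfolding invariantly_universal_def
    using standard_borel_colored_LO analytic_equivalence_colored_iso S
    by (auto simp: analytic_quasi_order_def[of "_ :: 'b measure"] intro!: bireducible_invariant_set)
qed

theorem theorem5p8:
  shows "(\<forall>S. analytic_quasi_order colored_LO S \<and>
              colored_emb Id \<subseteq> S \<and> S \<subseteq> colored_emb geq_rel \<longrightarrow>
              invariantly_universal TYPE('b) colored_LO S colored_iso) \<and>
         invariantly_universal TYPE('b) colored_LO (colored_emb Id) colored_iso \<and>
         invariantly_universal TYPE('b) colored_LO (colored_emb geq_rel) colored_iso \<and>
         (\<forall>R. preorder_on UNIV R \<and> R \<subseteq> geq_rel \<longrightarrow>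
              invariantly_universal TYPE('b) colored_LO (colored_emb R) colored_iso)"
proof -
  have mono: "colored_emb R \<subseteq> colored_emb R'" if "R \<subseteq> R'" for R R'
    using that unfolding colored_emb_def by blast
  have emb: "invariantly_universal TYPE('b) colored_LO (colored_emb R) colored_iso"
    if R: "preorder_on UNIV R" "R \<subseteq> geq_rel" for R
  proof (rule invariantly_universal_between)
    have "Id \<subseteq> R"
      using R(1) by (auto simp: preorder_on_def refl_on_def)
    then show "colored_emb Id \<subseteq> colored_emb R"
      by (rule mono)
  qed (use R mono analytic_quasi_order_colored_emb in auto)
  have "preorder_on UNIV (Id :: nat rel)" "preorder_on UNIV geq_rel"
    by (auto simp: preorder_on_def refl_on_def intro: transI)
  then show ?thesis
    using emb invariantly_universal_between by auto
qed

end
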